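(* Let $\overline{N}(m,n)$ denote the number of overpartitions of $n$ with $D$-rank $m$, and let $\overline{N2}(m,n)$ denote the number of overpartitions of $n$ with $M_2$-rank $m$ (with the convention $\overline{N}(m,-1)=\overline{N2}(m,-1)=0$). Then: (i) For all integers $m,n\geq 0$ with $n\neq m+2$ and $(m,n)\neq (0,4)$, $$\overline{N}(m,n)\geq \overline{N}(m,n-1).$$ (ii) For all integers $m,n\geq 0$, $$\overline{N2}(m,n)\geq \overline{N2}(m,n-1).$$
   Context: An overpartition of a nonnegative integer $n$ is a partition of $n$ (a weakly decreasing finite sequence of positive integers summing to $n$) in which the first occurrence of each distinct part value may (or may not) be overlined. For an overpartition $\lambda$, let $\lambda_1$ be its largest part (taken to be $0$ for the empty overpartition) and $\ell(\lambda)$ its number of parts. The $D$-rank of $\lambda$ is $\lambda_1-\ell(\lambda)$. Let $\lambda_o$ denote the partition consisting of the non-overlined odd parts of $\lambda$, and let $\chi(\lambda)=1$ if the largest part of $\lambda$ is odd and non-overlined, and $\chi(\lambda)=0$ otherwise. The $M_2$-rank of $\lambda$ is $\lfloor \lambda_1/2\rfloor-\ell(\lambda)+\ell(\lambda_o)-\chi(\lambda)$. Equivalently, with $(a;q)_k=\prod_{i=0}^{k-1}(1-aq^i)$, $$\sum_{n\ge0}\sum_{m\in\mathbb{Z}}\overline{N}(m,n)z^mq^n=\sum_{k\ge0}\frac{(-1;q)_k q^{k(k+1)/2}}{(zq;q)_k(q/z;q)_k},\qquad \sum_{n\ge0}\sum_{m\in\mathbb{Z}}\overline{N2}(m,n)z^mq^n=\sum_{k\ge0}\frac{(-1;q)_{2k}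 q^{k}}{(zq^2;q^2)_k(q^2/z;q^2)_k}.$$
   Formalization: The M_2-rank is taken with ⌈λ_1/2⌉ in place of ⌊λ_1/2⌋: with the floor both overpartitions of 1 have rank −1, so (ii) fails at (m,n)=(0,1), whereas the ceiling agrees with the stated generating function. *)

theory Defs
  imports Complex_Main
begin

text \<open>
  A part is a pair of its value and a flag saying whether it is overlined.
\<close>

type_synonym part = "nat \<times> bool"

definition overpartition :: "part list \<Rightarrow> bool" where
  "overpartition xs \<longleftrightarrow>
     sorted_wrt (\<ge>) (map fst xs) \<and>
     (\<forall>p \<in> set xs. 0 < fst p) \<and>
     (\<forall>i < length xs. snd (xs ! i) \<longrightarrow> (\<forall>j < i. fst (xs ! j) \<noteq> fst (xs ! i)))"

text \<open>
  The weight is an integer so that there are no overpartitions of \<open>-1\<close>, as the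
  convention for the rank counts at \<open>n = -1\<close> requires.
\<close>

definition overpartitions_of :: "int \<Rightarrow> part list set" where
  "overpartitions_of n = {xs. overpartition xs \<and> int (sum_list (map fst xs)) = n}"

definition largest_part :: "part list \<Rightarrow> nat" where
  "largest_part xs = (if xs = [] then 0 else fst (hd xs))"

definition D_rank :: "part list \<Rightarrow> int" where
  "D_rank xs = int (largest_part xs) - int (length xs)"

definition nonoverlined_odd_parts :: "part list \<Rightarrow> part list" where
  "nonoverlined_odd_parts xs = filter (\<lambda>p. odd (fst p) \<and> \<not> snd p) xs"

text \<open>
  If the largest value is overlined, then it is overlined at its first occurrence, which is
  the head of the list.
\<close>

definition chi :: "part list \<Rightarrow> int" where
  "chi xs = (if xs \<noteq> [] \<and> odd (fst (hd xs)) \<and> \<not> snd (hd xs) then 1 else 0)"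

text \<open>
  Half of the largest part is rounded up, as in Lovejoy's definition of the \<open>M\<^sub>2\<close>-rank. This is
  the rounding for which the counts have the generating function
  \<open>\<Sum>k. (-1;q)\<^bsub>2k\<^esub> q^k / ((zq^2;q^2)\<^bsub>k\<^esub> (q^2/z;q^2)\<^bsub>k\<^esub>)\<close>. With rounding down, both overpartitions
  of 1 would have rank \<open>-1\<close>, whereas that series has \<open>q\<close>-coefficient 2 at \<open>z^0\<close>.
\<close>

definition M2_rank :: "part list \<Rightarrow> int" where
  "M2_rank xs =
     \<lceil>real (largest_part xs) / 2\<rceil> - int (length xs)
       + int (length (nonoverlined_odd_parts xs)) - chi xs"

definition N_bar :: "int \<Rightarrow> int \<Rightarrow> nat" where
  "N_bar m n = card {xs \<in> overpartitions_of n. D_rank xs = m}"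

definition N2_bar :: "int \<Rightarrow> int \<Rightarrow> nat" where
  "N2_bar m n = card {xs \<in> overpartitions_of n. M2_rank xs = m}"

lemma finite_overpartitions_of: "finite (overpartitions_of n)"
proof (rule finite_subset)
  show "overpartitions_of n \<subseteq>
      {xs. set xs \<subseteq> {..nat n} \<times> UNIV \<and> length xs \<le> nat n}"
  proof
    fix xs assume "xs \<in> overpartitions_of n"
    then have pos: "\<forall>p \<in> set xs. 0 < fst p" and s: "sum_list (map fst xs) = nat n"
      by (auto simp: overpartitions_of_def overpartition_def)
    have "fst p \<le> nat n" if "p \<in> set xs" for p
      using member_le_sum_list[of "fst p" "map fst xs"] that s by auto
    moreover have "length xs \<le> sum_list (map fst xs)"
      using pos by (induction xs) auto
    ultimately show "xs \<in> {xs. set xs \<subseteq> {..nat n} \<times> UNIV \<and> length xs \<le> nat n}"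
      using s by (auto simp: mem_Times_iff)
  qed
  show "finite {xs. set xs \<subseteq> {..nat n} \<times> (UNIV :: bool set) \<and> length xs \<le> nat n}"
    by (rule finite_lists_length_le) simp
qed

end

theory Submission
  imports Defs "HOL-Computational_Algebra.Formal_Power_Series"
begin

text \<open>
  Both ranks are differences \<open>a - l\<close>, where \<open>l\<close> is the number of parts. Removing the parts of size 1
  (respectively 1 and 2) and lowering all other parts shows that the generating function
  \<open>F(x, y) = \<Sum> x^a y^l q^n\<close> over all overpartitions satisfies
  \<open>(1 - xy\<alpha>) F(x, y) = (1 - x) + x (1 + y\<alpha>) (1 + yp) / (1 - yp) F(x, yp)\<close>,
  with \<open>(\<alpha>, p) = (0, q)\<close> for the \<open>D\<close>-rank and \<open>(q, q\<^sup>2)\<close> for the \<open>M\<^sub>2\<close>-rank. The series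
  \<open>\<Sum>k. T\<^sub>k\<close>, \<open>T\<^sub>k = c\<^sub>k (xy)^k / ((xp;p)\<^sub>k (yp;p)\<^sub>k)\<close>, satisfies the same equation, because
  \<open>U\<^sub>k = (1 - x p^k) T\<^sub>k\<close> makes it telescope, and the equation has only one solution.

  For \<open>k \<ge> 2\<close> the coefficient \<open>c\<^sub>k\<close> contains the factor \<open>(1 - p\<^sup>2) / (1 - q)\<close>, and
  \<open>(1 - p\<^sup>2) / ((1 - zp) (1 - p/z)) = \<Sum>m. p^\<bar>m\<bar> z^m\<close> has nonnegative coefficients, hence so has
  \<open>1 - q\<close> times the \<open>k\<close>-th term. The few negative coefficients from \<open>k \<le> 1\<close> are compensated by the
  terms with \<open>k = 2\<close> and \<open>k = 3\<close>.
\<close>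

subsection \<open>The functional equation and its solution\<close>

definition geo :: "'a::comm_ring_1 \<Rightarrow> 'a fps" where
  "geo c = Abs_fps (\<lambda>n. c ^ n)"

text \<open>The inverse of \<open>(pX;p)_k\<close>, built from geometric series so that no division
  of nested power series is needed. The coefficient of \<open>X^j\<close> enumerates partitions into
  \<open>j\<close> parts of size at most \<open>k\<close>.\<close>

definition qpoch_inv :: "'a::comm_ring_1 \<Rightarrow> nat \<Rightarrow> 'a fps" where
  "qpoch_inv p k = (\<Prod>i=1..k. geo (p ^ i))"

text \<open>The substitution of \<open>cX\<close> for \<open>X\<close>; it realises the passage from
  \<open>y\<close> to \<open>yp\<close>.\<close>

definition dilate :: "'a::comm_ring_1 \<Rightarrow> 'a fps \<Rightarrow> 'a fps" where
  "dilate c F = Abs_fps (\<lambda>n. c ^ n * fps_nth F n)"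

lemma geo_nth [simp]: "fps_nth (geo c) n = c ^ n"
  by (simp add: geo_def)

lemma dilate_nth [simp]: "fps_nth (dilate c F) n = c ^ n * fps_nth F n"
  by (simp add: dilate_def)

lemma one_minus_mult_geo: "(1 - fps_const c * fps_X) * geo c = 1"
proof (rule fps_ext)
  fix n
  show "fps_nth ((1 - fps_const c * fps_X) * geo c) n = fps_nth 1 n"
    by (cases n) (simp_all add: left_diff_distrib mult.assoc)
qed

lemma dilate_mult: "dilate c (F * G) = dilate c F * dilate c G"
proof (rule fps_ext)
  fix n
  have "c ^ n * (fps_nth F i * fps_nth G (n - i)) =
      (c ^ i * fps_nth F i) * (c ^ (n - i) * fps_nth G (n - i))" if "i \<le> n" for i
  proof -
    have "c ^ n = c ^ i * c ^ (n - i)"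
      using that by (simp flip: power_add)
    then show ?thesis by (simp add: algebra_simps)
  qed
  then show "fps_nth (dilate c (F * G)) n = fps_nth (dilate c F * dilate c G) n"
    by (simp add: fps_mult_nth sum_distrib_left)
qed

lemma dilate_add: "dilate c (F + G) = dilate c F + dilate c G"
  by (rule fps_ext) (simp add: algebra_simps)

lemma dilate_diff: "dilate c (F - G) = dilate c F - dilate c G"
  by (rule fps_ext) (simp add: algebra_simps)

lemma dilate_const: "dilate c (fps_const a) = fps_const a"
  by (rule fps_ext) simp

lemma dilate_zero: "dilate c 0 = 0"
  by (rule fps_ext) simp

lemma dilate_one: "dilate c 1 = 1"
  using dilate_const[of c 1] by simp

lemma dilate_X: "dilate c fps_X = fps_const c * fps_X"
  by (rule fps_ext) (auto simp: fps_X_def)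

lemma dilate_power: "dilate c (F ^ n) = dilate c F ^ n"
  by (induction n) (simp_all add: dilate_one dilate_mult)

lemma dilate_sum: "dilate c (\<Sum>i\<in>A. f i) = (\<Sum>i\<in>A. dilate c (f i))"
  by (rule fps_ext) (simp add: fps_sum_nth sum_distrib_left)

lemma dilate_geo: "dilate c (geo d) = geo (c * d)"
  by (rule fps_ext) (simp add: power_mult_distrib)

lemma qpoch_inv_0 [simp]: "qpoch_inv p 0 = 1"
  by (simp add: qpoch_inv_def)

lemma qpoch_inv_Suc: "qpoch_inv p (Suc k) = qpoch_inv p k * geo (p ^ Suc k)"
  by (simp add: qpoch_inv_def)

text \<open>Replacing \<open>X\<close> by \<open>pX\<close> moves the factors with index
  \<open>1..k\<close> to \<open>2..k+1\<close>: the first factor is cancelled and a new last one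
  appears.\<close>

lemma dilate_qpoch_inv:
  "dilate p (qpoch_inv p k) = (1 - fps_const p * fps_X) * qpoch_inv p k * geo (p ^ Suc k)"
proof (induction k)
  case 0
  then show ?case using one_minus_mult_geo[of p] by (simp add: dilate_one)
next
  case (Suc k)
  then show ?case
    by (simp add: qpoch_inv_Suc dilate_mult dilate_geo mult_ac del: power_Suc)
      (simp add: mult_ac)
qed

text \<open>The \<open>y\<close>-product lives over series in \<open>x\<close>, but its coefficients
  are constant in \<open>x\<close>. Hence both products in \<open>rank_term\<close> have the same
  coefficients.\<close>

lemma qpoch_inv_const_nth:
  "fps_nth (qpoch_inv (fps_const p) k) l = fps_const (fps_nth (qpoch_inv p k) l)"
proof (induction k arbitrary: l)
  case 0
  then show ?case by simp
next
  case (Suc k)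
  show ?case
    by (rule fps_ext) (simp add: qpoch_inv_Suc fps_mult_nth Suc.IH fps_sum_nth fps_const_power del: power_Suc)
qed

text \<open>This is \<open>(-1;q)_k q^(k(k+1)/2)\<close> for \<open>(\<alpha>, p) = (0, q)\<close>.
  For \<open>(q, q^2)\<close> it is \<open>(-1;q)_(2k) q^k\<close>, because
  \<open>q + q^(2i+2) = q (1 + q^(2i+1))\<close>.\<close>

definition term_coeff :: "'a::comm_ring_1 \<Rightarrow> 'a \<Rightarrow> nat \<Rightarrow> 'a" where
  "term_coeff \<alpha> p k = (\<Prod>i<k. (1 + p ^ i) * (\<alpha> + p * p ^ i))"

abbreviation fps_const2 :: "'a::comm_ring_1 \<Rightarrow> 'a fps fps" where
  "fps_const2 c \<equiv> fps_const (fps_const c)"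

abbreviation x_var :: "'a::comm_ring_1 fps fps" where
  "x_var \<equiv> fps_const fps_X"

abbreviation y_var :: "'a::comm_ring_1 fps fps" where
  "y_var \<equiv> fps_X"

text \<open>
  With \<open>\<alpha> = 0\<close>, \<open>p = q\<close> these are the terms for the \<open>D\<close>-rank, with \<open>\<alpha> = q\<close>, \<open>p = q\<^sup>2\<close>
  those for the \<open>M\<^sub>2\<close>-rank; the rank is the exponent of \<open>x\<close> minus the exponent of \<open>y\<close>.
\<close>

definition rank_term :: "'a::comm_ring_1 \<Rightarrow> 'a \<Rightarrow> nat \<Rightarrow> 'a fps fps" where
  "rank_term \<alpha> p k = fps_const2 (term_coeff \<alpha> p k) * (x_var * y_var) ^ k *
      fps_const (qpoch_inv p k) * qpoch_inv (fps_const p) k"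

lemma term_coeff_Suc: "term_coeff \<alpha> p (Suc k) = term_coeff \<alpha> p k * ((1 + p ^ k) * (\<alpha> + p * p ^ k))"
  by (simp add: term_coeff_def)

lemma rank_term_0 [simp]: "rank_term \<alpha> p 0 = 1"
  by (simp add: rank_term_def term_coeff_def)

lemma rank_term_nth:
  "fps_nth (fps_nth (rank_term \<alpha> p k) l) a =
    (if k \<le> l \<and> k \<le> a
     then term_coeff \<alpha> p k * fps_nth (qpoch_inv p k) (a - k) * fps_nth (qpoch_inv p k) (l - k) else 0)"
proof -
  have "rank_term \<alpha> p k = y_var ^ k * (fps_const (fps_const (term_coeff \<alpha> p k) * fps_X ^ k * qpoch_inv p k)
      * qpoch_inv (fps_const p) k)"
    by (simp add: rank_term_def power_mult_distrib mult_ac flip: fps_const_mult fps_const_power)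
  then have "fps_nth (rank_term \<alpha> p k) l = (if l < k then 0 else
      fps_X ^ k * (fps_const (term_coeff \<alpha> p k) * qpoch_inv p k * fps_const (fps_nth (qpoch_inv p k) (l - k))))"
    by (simp add: fps_X_power_mult_nth qpoch_inv_const_nth mult_ac)
  then show ?thesis
    by (simp add: fps_X_power_mult_nth)
qed

text \<open>To be read with \<open>T = T_k\<close>, \<open>Q = p^k\<close>,
  \<open>a = \<alpha>\<close> and \<open>g = 1 / (1 - p^(k+1) y)\<close>. The two sides differ by a
  multiple of \<open>1 - (1 - p * Q * y) * g\<close>.\<close>

lemma telescope_identity:
  fixes x y a p Q g T :: "'a::comm_ring_1"
  assumes "(1 - p * Q * y) * g = 1"
  shows "(1 - x * y * a) * (1 - p * y) * T - x * (1 + y * a) * (1 + y * p) * (Q * (1 - p * y) * g * T) =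
    (1 - p * y) * ((1 - x * Q) * T - T * (1 + Q) * (a + p * Q) * x * y * g)" (is "?l = ?r")
proof -
  have "?l - ?r = (1 - p * y) * T * (x * Q - x * y * a) * (1 - (1 - p * Q * y) * g)"
    by (simp add: algebra_simps)
  then show ?thesis
    using assms by simp
qed

text \<open>The right side is \<open>(1 - py) (U_k - U_(k+1))\<close> with
  \<open>U_k = (1 - x p^k) T_k\<close>; the factor \<open>1 - py\<close> clears the denominator of
  the functional equation.\<close>

lemma rank_term_telescope:
  fixes \<alpha> p :: "'a::comm_ring_1"
  shows "(1 - x_var * y_var * fps_const2 \<alpha>) * (1 - fps_const2 p * y_var) * rank_term \<alpha> p k -
      x_var * (1 + y_var * fps_const2 \<alpha>) * (1 + y_var * fps_const2 p) * dilate (fps_const p) (rank_term \<alpha> p k) =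
    (1 - fps_const2 p * y_var) * ((1 - x_var * fps_const2 p ^ k) * rank_term \<alpha> p k -
      (1 - x_var * fps_const2 p ^ Suc k) * rank_term \<alpha> p (Suc k))"
proof -
  define g :: "'a fps fps" where "g = geo (fps_const p ^ Suc k)"
  define T where "T = rank_term \<alpha> p k"
  define Q where "Q = fps_const2 p ^ k"
  define gx :: "'a fps fps" where "gx = fps_const (geo (p ^ Suc k))"
  have g: "(1 - fps_const2 p * Q * y_var) * g = 1"
    using one_minus_mult_geo[of "fps_const p ^ Suc k"]
    by (simp add: g_def Q_def fps_const_power)
  have gx: "(1 - fps_const2 p * Q * x_var) * gx = 1"
    using arg_cong[OF one_minus_mult_geo[of "p ^ Suc k"], of fps_const]
    by (simp add: gx_def Q_def fps_const_power flip: fps_const_mult fps_const_1_eq_1 fps_const_sub)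
  \<comment> \<open>The power \<open>(xy)^k\<close> contributes \<open>Q\<close>; the other two
    factors come from \<open>dilate_qpoch_inv\<close>.\<close>
  have dil: "dilate (fps_const p) T = Q * (1 - fps_const2 p * y_var) * g * T"
    by (simp add: T_def rank_term_def dilate_mult dilate_power dilate_const dilate_X dilate_qpoch_inv
        power_mult_distrib g_def Q_def mult_ac flip: fps_const_mult fps_const_power)
  have Suc: "rank_term \<alpha> p (Suc k) = T * (1 + Q) * (fps_const2 \<alpha> + fps_const2 p * Q) * x_var * y_var * gx * g"
    by (simp add: T_def rank_term_def term_coeff_Suc qpoch_inv_Suc g_def gx_def Q_def mult_ac fps_const_power
       flip: fps_const_mult fps_const_add fps_const_1_eq_1)
  have "(1 - x_var * fps_const2 p ^ Suc k) * rank_term \<alpha> p (Suc k) =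
     T * (1 + Q) * (fps_const2 \<alpha> + fps_const2 p * Q) * x_var * y_var * g * ((1 - fps_const2 p * Q * x_var) * gx)"
    by (simp add: Suc Q_def mult_ac)
  also have "\<dots> = T * (1 + Q) * (fps_const2 \<alpha> + fps_const2 p * Q) * x_var * y_var * g"
    by (simp add: gx)
  finally have U: "(1 - x_var * fps_const2 p ^ Suc k) * rank_term \<alpha> p (Suc k) =
    T * (1 + Q) * (fps_const2 \<alpha> + fps_const2 p * Q) * x_var * y_var * g" .
  show ?thesis
    unfolding U
    unfolding T_def[symmetric] dil Q_def[symmetric]
    by (rule telescope_identity) (rule g)
qed

section \<open>The functional equation with denominators cleared, and its unique solution\<close>

definition functional_eq :: "'a::comm_ring_1 \<Rightarrow> 'a \<Rightarrow> 'a fps fps \<Rightarrow> bool" where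
  "functional_eq \<alpha> p F \<longleftrightarrow>
    (1 - x_var * y_var * fps_const2 \<alpha>) * (1 - fps_const2 p * y_var) * F =
    (1 - x_var) * (1 - fps_const2 p * y_var) +
    x_var * (1 + y_var * fps_const2 \<alpha>) * (1 + y_var * fps_const2 p) * dilate (fps_const p) F"

lemma rank_term_sum:
  "(1 - x_var * y_var * fps_const2 \<alpha>) * (1 - fps_const2 p * y_var) * (\<Sum>k<K. rank_term \<alpha> p k) -
      x_var * (1 + y_var * fps_const2 \<alpha>) * (1 + y_var * fps_const2 p) * dilate (fps_const p) (\<Sum>k<K. rank_term \<alpha> p k) =
    (1 - fps_const2 p * y_var) * ((1 - x_var) - (1 - x_var * fps_const2 p ^ K) * rank_term \<alpha> p K)"
proof (induction K)
  case 0
  show ?case by (simp add: dilate_zero)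
next
  case (Suc K)
  show ?case
    using arg_cong2[OF Suc.IH rank_term_telescope[of \<alpha> p K], of "(+)"]
    by (simp add: dilate_add dilate_sum algebra_simps del: power_Suc)
qed

text \<open>If all lower coefficients of \<open>D\<close> vanish, only the \<open>y\<close>-constant
  terms of the multipliers matter at \<open>y^l\<close>. There the equation reads
  \<open>D_l = x p^l D_l\<close>, and \<open>1 - x p^l\<close> is nonzero. The error
  \<open>E\<close> of order \<open>K\<close> in \<open>y\<close> makes room for truncated
  sums.\<close>

lemma functional_eq_nth_unique:
  fixes \<alpha> p :: "'a::idom" and D E :: "'a fps fps"
  assumes eq: "(1 - x_var * y_var * fps_const2 \<alpha>) * (1 - fps_const2 p * y_var) * D =
      x_var * (1 + y_var * fps_const2 \<alpha>) * (1 + y_var * fps_const2 p) * dilate (fps_const p) D + E"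
    and E: "\<And>l. l < K \<Longrightarrow> fps_nth E l = 0" and "l < K"
  shows "fps_nth D l = 0"
  using \<open>l < K\<close>
proof (induction l rule: less_induct)
  case (less l)
  have low: "fps_nth D i = 0" if "i < l" for i
    using less that by simp
  have lowd: "fps_nth (dilate (fps_const p) D) i = 0" if "i < l" for i
    using low[OF that] by simp
  have *: "fps_nth (A * B) l = fps_nth A 0 * fps_nth B l"
    if "\<And>i. i < l \<Longrightarrow> fps_nth B i = 0" for A B :: "'a fps fps"
  proof -
    have "fps_nth (A * B) l = (\<Sum>i=0..l. fps_nth A i * fps_nth B (l - i))"
      by (simp add: fps_mult_nth)
    also have "\<dots> = (\<Sum>i\<in>{0}. fps_nth A i * fps_nth B (l - i))"
      by (rule sum.mono_neutral_right) (auto simp: that)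
    finally show ?thesis by simp
  qed
  have "fps_nth D l = fps_X * (fps_const (p ^ l) * fps_nth D l)"
    using arg_cong[OF eq, of "\<lambda>F. fps_nth F l"] E[OF less.prems]
    by (simp add: *[OF low] *[OF lowd] fps_const_power)
  then have "(1 - fps_X * fps_const (p ^ l)) * fps_nth D l = 0"
    by (simp add: algebra_simps)
  moreover have "1 - fps_X * fps_const (p ^ l) \<noteq> 0"
  proof
    assume "1 - fps_X * fps_const (p ^ l) = 0"
    then have "fps_nth (1 - fps_X * fps_const (p ^ l)) 0 = 0"
      by simp
    then show False by simp
  qed
  ultimately show ?case by simp
qed

text \<open>The partial sum up to \<open>L\<close> solves the equation with an error that is a
  multiple of \<open>T_(L+1)\<close>, hence divisible by \<open>y^(L+1)\<close>. So no infinite sum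
  is needed.\<close>

lemma functional_eq_nth:
  fixes \<alpha> p :: "'a::idom"
  assumes "functional_eq \<alpha> p F" "l \<le> L"
  shows "fps_nth (fps_nth F l) a = (\<Sum>k\<le>L. fps_nth (fps_nth (rank_term \<alpha> p k) l) a)"
proof -
  let ?S = "\<Sum>k<Suc L. rank_term \<alpha> p k"
  let ?E = "(1 - fps_const2 p * y_var) * ((1 - x_var * fps_const2 p ^ Suc L) * rank_term \<alpha> p (Suc L))"
  have lin: "M * (G - S) = N * (G' - S') + B * U"
    if "M * G = C * B + N * G'" "M * S - N * S' = B * (C - U)" for M N B C G S G' S' U :: "'a fps fps"
  proof -
    have "M * S = B * (C - U) + N * S'"
      using that(2) by (simp add: diff_eq_eq)
    with that(1) show ?thesis
      by (simp add: algebra_simps)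
  qed
  have "(1 - x_var * y_var * fps_const2 \<alpha>) * (1 - fps_const2 p * y_var) * (F - ?S) =
      x_var * (1 + y_var * fps_const2 \<alpha>) * (1 + y_var * fps_const2 p) * dilate (fps_const p) (F - ?S) + ?E"
    unfolding dilate_diff
    by (rule lin[OF assms(1)[unfolded functional_eq_def] rank_term_sum])
  moreover have "fps_nth ?E i = 0" if "i < Suc L" for i
  proof -
    have "fps_nth (rank_term \<alpha> p (Suc L)) j = 0" if "j < Suc L" for j
      using that by (intro fps_ext) (simp add: rank_term_nth)
    then show ?thesis
      using that unfolding mult.assoc[symmetric] by (subst fps_mult_nth) (auto intro!: sum.neutral)
  qed
  ultimately have "fps_nth (F - ?S) l = 0"
    by (rule functional_eq_nth_unique) (use assms in auto)
  then show ?thesis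
    by (simp add: fps_sum_nth lessThan_Suc_atMost del: sum.lessThan_Suc)
qed

subsection \<open>Generating functions of overpartitions\<close>

abbreviation weight :: "part list \<Rightarrow> nat" where
  "weight xs \<equiv> sum_list (map fst xs)"

text \<open>The first part may be counted by another rule than the later ones. On the empty list the
  value is unspecified, so that list is kept out of the generating functions used below.\<close>

definition stat :: "(part \<Rightarrow> nat) \<Rightarrow> (part \<Rightarrow> nat) \<Rightarrow> part list \<Rightarrow> nat" where
  "stat h t xs = h (hd xs) + sum_list (map t (tl xs))"

definition cells :: "(part \<Rightarrow> nat) \<Rightarrow> (part \<Rightarrow> nat) \<Rightarrow> part list set \<Rightarrow> nat \<Rightarrow> nat \<Rightarrow> nat \<Rightarrow> part list set" where
  "cells h t S l a n = {xs \<in> S. length xs = l \<and> stat h t xs = a \<and> weight xs = n}"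

text \<open>The nesting is that of \<open>rank_term\<close>: the outer variable \<open>y\<close>
  marks the length, the middle one \<open>x\<close> the statistic, the inner one \<open>q\<close>
  the weight.\<close>

definition gf :: "(part \<Rightarrow> nat) \<Rightarrow> (part \<Rightarrow> nat) \<Rightarrow> part list set \<Rightarrow> int fps fps fps" where
  "gf h t S = Abs_fps (\<lambda>l. Abs_fps (\<lambda>a. Abs_fps (\<lambda>n. int (card (cells h t S l a n)))))"

lemma gf_nth: "fps_nth (fps_nth (fps_nth (gf h t S) l) a) n = int (card (cells h t S l a n))"
  by (simp add: gf_def)

lemma gf_eqI:
  assumes "\<And>l a n. fps_nth (fps_nth (fps_nth F l) a) n = fps_nth (fps_nth (fps_nth G l) a) n"
  shows "F = (G :: int fps fps fps)"
  using assms by (intro fps_ext) auto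

lemma finite_cells: "finite (cells h t S l a n)"
proof (rule finite_subset)
  show "cells h t S l a n \<subseteq> {xs. set xs \<subseteq> {..n} \<times> UNIV \<and> length xs = l}"
  proof
    fix xs assume "xs \<in> cells h t S l a n"
    then have "weight xs = n" "length xs = l"
      by (auto simp: cells_def)
    moreover have "fst p \<le> weight xs" if "p \<in> set xs" for p
      using that by (intro member_le_sum_list) auto
    ultimately show "xs \<in> {xs. set xs \<subseteq> {..n} \<times> UNIV \<and> length xs = l}"
      by (auto simp: mem_Times_iff)
  qed
  show "finite {xs. set xs \<subseteq> {..n} \<times> (UNIV :: bool set) \<and> length xs = l}"
    by (rule finite_lists_length_eq) simp
qed

lemma gf_Un:
  assumes "A \<inter> B = {}"
  shows "gf h t (A \<union> B) = gf h t A + gf h t B"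
proof (rule gf_eqI)
  fix l a n
  have "cells h t (A \<union> B) l a n = cells h t A l a n \<union> cells h t B l a n"
    by (auto simp: cells_def)
  moreover have "cells h t A l a n \<inter> cells h t B l a n = {}"
    using assms by (auto simp: cells_def)
  ultimately show "fps_nth (fps_nth (fps_nth (gf h t (A \<union> B)) l) a) n =
      fps_nth (fps_nth (fps_nth (gf h t A + gf h t B) l) a) n"
    by (simp add: gf_nth card_Un_disjoint finite_cells)
qed

lemma monomial_mult_nth:
  fixes F :: "int fps fps fps"
  shows "fps_nth (fps_nth (fps_nth (fps_const2 (fps_X ^ v) * x_var ^ i * y_var * F) l) a) n =
    (if 1 \<le> l \<and> i \<le> a \<and> v \<le> n then fps_nth (fps_nth (fps_nth F (l - 1)) (a - i)) (n - v) else 0)"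
proof -
  have eq: "fps_const2 (fps_X ^ v) * x_var ^ i * y_var * F =
      y_var * (fps_const (fps_X ^ i) * (fps_const2 (fps_X ^ v) * F))"
    by (simp add: mult_ac fps_const_power flip: fps_const_mult)
  show ?thesis
    unfolding eq by (simp add: fps_X_power_mult_nth not_le)
qed

text \<open>Appending leaves the head alone, so the new part is counted by \<open>t\<close>.
  Appended to \<open>[]\<close> it would be the head and be counted by \<open>h\<close>.\<close>

lemma gf_snoc:
  assumes "[] \<notin> C"
  shows "gf h t ((\<lambda>xs. xs @ [p]) ` C) = fps_const2 (fps_X ^ fst p) * x_var ^ t p * y_var * gf h t C"
proof (rule gf_eqI)
  fix l a n
  have stat: "stat h t (xs @ [p]) = stat h t xs + t p" if "xs \<in> C" for xs
    using that assms by (cases xs) (auto simp: stat_def)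
  have "card (cells h t ((\<lambda>xs. xs @ [p]) ` C) l a n) =
    (if 1 \<le> l \<and> t p \<le> a \<and> fst p \<le> n then card (cells h t C (l - 1) (a - t p) (n - fst p)) else 0)"
  proof (cases "1 \<le> l \<and> t p \<le> a \<and> fst p \<le> n")
    case True
    then have "cells h t ((\<lambda>xs. xs @ [p]) ` C) l a n =
        (\<lambda>xs. xs @ [p]) ` cells h t C (l - 1) (a - t p) (n - fst p)"
      using stat by (auto simp: cells_def)
    then show ?thesis
      using True by (simp add: card_image inj_on_def)
  next
    case False
    then have "cells h t ((\<lambda>xs. xs @ [p]) ` C) l a n = {}"
      using stat by (auto simp: cells_def)
    then show ?thesis using False by auto
  qed
  then show "fps_nth (fps_nth (fps_nth (gf h t ((\<lambda>xs. xs @ [p]) ` C)) l) a) n =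
    fps_nth (fps_nth (fps_nth (fps_const2 (fps_X ^ fst p) * x_var ^ t p * y_var * gf h t C) l) a) n"
    unfolding gf_nth monomial_mult_nth by simp
qed

lemma gf_singleton: "gf h t {[p]} = fps_const2 (fps_X ^ fst p) * x_var ^ h p * y_var"
proof (rule gf_eqI)
  fix l a n
  have "cells h t {[p]} l a n = (if l = 1 \<and> a = h p \<and> n = fst p then {[p]} else {})"
    by (auto simp: cells_def stat_def)
  then show "fps_nth (fps_nth (fps_nth (gf h t {[p]}) l) a) n =
      fps_nth (fps_nth (fps_nth (fps_const2 (fps_X ^ fst p) * x_var ^ h p * y_var) l) a) n"
    using monomial_mult_nth[of "fst p" "h p" 1 l a n]
    by (auto simp: gf_nth)
qed

section \<open>Stripping the smallest parts\<close>

definition parts_ge :: "nat \<Rightarrow> part list set" where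
  "parts_ge v = {xs. overpartition xs \<and> xs \<noteq> [] \<and> (\<forall>p\<in>set xs. v \<le> fst p)}"

text \<open>The stage between \<open>parts_ge v\<close> and \<open>parts_ge (Suc v)\<close>: the
  value \<open>v\<close> may occur only overlined, hence at most once.\<close>

definition parts_ge_overlined :: "nat \<Rightarrow> part list set" where
  "parts_ge_overlined v =
    {xs. overpartition xs \<and> xs \<noteq> [] \<and> (\<forall>p\<in>set xs. v < fst p \<or> v = fst p \<and> snd p)}"

lemma overpartition_Nil [simp]: "overpartition []"
  by (simp add: overpartition_def)

text \<open>Overpartitions are built by appending smallest parts: an overlined part must start a new
  value, a non-overlined one may repeat the smallest value so far.\<close>

lemma overpartition_snoc:
  "overpartition (xs @ [p]) \<longleftrightarrow> overpartition xs \<and> 0 < fst p \<and>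
    (\<forall>r\<in>set xs. fst p < fst r \<or> fst p = fst r \<and> \<not> snd p)"
proof -
  have "(\<forall>i<length (xs @ [p]). snd ((xs @ [p]) ! i) \<longrightarrow>
        (\<forall>j<i. fst ((xs @ [p]) ! j) \<noteq> fst ((xs @ [p]) ! i))) \<longleftrightarrow>
      (\<forall>i<length xs. snd (xs ! i) \<longrightarrow> (\<forall>j<i. fst (xs ! j) \<noteq> fst (xs ! i))) \<and>
      (snd p \<longrightarrow> (\<forall>r\<in>set xs. fst r \<noteq> fst p))"
    by (auto simp: less_Suc_eq nth_append all_set_conv_all_nth)
  moreover have "sorted_wrt (\<ge>) (map fst (xs @ [p])) \<longleftrightarrow>
      sorted_wrt (\<ge>) (map fst xs) \<and> (\<forall>r\<in>set xs. fst p \<le> fst r)"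
    by (auto simp: sorted_wrt_append)
  moreover have "(\<forall>r\<in>set (xs @ [p]). 0 < fst r) \<longleftrightarrow> (\<forall>r\<in>set xs. 0 < fst r) \<and> 0 < fst p"
    by auto
  moreover have "(\<forall>r\<in>set xs. fst p < fst r \<or> fst p = fst r \<and> \<not> snd p) \<longleftrightarrow>
      (\<forall>r\<in>set xs. fst p \<le> fst r) \<and> (snd p \<longrightarrow> (\<forall>r\<in>set xs. fst r \<noteq> fst p))"
    by (cases "snd p") (fastforce simp: le_less)+
  ultimately show ?thesis
    unfolding overpartition_def by blast
qed

text \<open>The cases are distinguished by the last entry. Copies of \<open>v\<close> stand at the
  end, an overlined one before the others, so if the last entry is not \<open>(v, False)\<close>, no
  entry is. The singleton is kept apart because removing its only part leaves
  \<open>[]\<close>.\<close>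

lemma parts_ge_decompose:
  assumes "0 < v"
  shows "parts_ge v = parts_ge_overlined v \<union>
    (\<lambda>xs. xs @ [(v, False)]) ` parts_ge v \<union> {[(v, False)]}"
proof (intro equalityI subsetI)
  fix xs assume xs: "xs \<in> parts_ge v"
  then obtain ys p where ys: "xs = ys @ [p]"
    by (cases xs rule: rev_cases) (auto simp: parts_ge_def)
  show "xs \<in> parts_ge_overlined v \<union> (\<lambda>xs. xs @ [(v, False)]) ` parts_ge v \<union> {[(v, False)]}"
  proof (cases "p = (v, False)")
    case True
    then show ?thesis
      using xs ys by (cases "ys = []") (auto simp: parts_ge_def overpartition_snoc)
  next
    case False
    then have "v < fst p \<or> v = fst p \<and> snd p"
      using xs ys by (cases p) (auto simp: parts_ge_def)
    then have "xs \<in> parts_ge_overlined v"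
      using xs ys by (fastforce simp: parts_ge_def parts_ge_overlined_def overpartition_snoc)
    then show ?thesis by blast
  qed
next
  fix xs assume "xs \<in> parts_ge_overlined v \<union> (\<lambda>xs. xs @ [(v, False)]) ` parts_ge v \<union> {[(v, False)]}"
  then show "xs \<in> parts_ge v"
    using assms overpartition_snoc[of "[]" "(v, False)"]
    by (fastforce simp: parts_ge_def parts_ge_overlined_def overpartition_snoc)
qed

lemma parts_ge_overlined_decompose:
  assumes "0 < v"
  shows "parts_ge_overlined v = parts_ge (Suc v) \<union>
    (\<lambda>xs. xs @ [(v, True)]) ` parts_ge (Suc v) \<union> {[(v, True)]}"
proof (intro equalityI subsetI)
  fix xs assume xs: "xs \<in> parts_ge_overlined v"
  then obtain ys p where ys: "xs = ys @ [p]"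
    by (cases xs rule: rev_cases) (auto simp: parts_ge_overlined_def)
  show "xs \<in> parts_ge (Suc v) \<union> (\<lambda>xs. xs @ [(v, True)]) ` parts_ge (Suc v) \<union> {[(v, True)]}"
  proof (cases "p = (v, True)")
    case True
    then show ?thesis
      using xs ys
      by (cases "ys = []") (fastforce simp: parts_ge_def parts_ge_overlined_def overpartition_snoc)+
  next
    case False
    then have "v < fst p"
      using xs ys by (cases p) (auto simp: parts_ge_overlined_def)
    then have "xs \<in> parts_ge (Suc v)"
      using xs ys by (fastforce simp: parts_ge_def parts_ge_overlined_def overpartition_snoc)
    then show ?thesis by blast
  qed
next
  fix xs assume "xs \<in> parts_ge (Suc v) \<union> (\<lambda>xs. xs @ [(v, True)]) ` parts_ge (Suc v) \<union> {[(v, True)]}"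
  then show "xs \<in> parts_ge_overlined v"
    using assms overpartition_snoc[of "[]" "(v, True)"]
    by (fastforce simp: parts_ge_def parts_ge_overlined_def overpartition_snoc)
qed

lemma gf_decompose:
  assumes S: "S = A \<union> (\<lambda>xs. xs @ [p]) ` C \<union> {[p]}" and "[] \<notin> C"
    and "\<And>xs. xs \<in> A \<Longrightarrow> last xs \<noteq> p"
  shows "gf h t S = gf h t A + fps_const2 (fps_X ^ fst p) * x_var ^ t p * y_var * gf h t C +
    fps_const2 (fps_X ^ fst p) * x_var ^ h p * y_var"
proof -
  have "gf h t S = gf h t (A \<union> (\<lambda>xs. xs @ [p]) ` C) + gf h t {[p]}"
    unfolding S using assms(2,3) by (intro gf_Un) fastforce
  also have "gf h t (A \<union> (\<lambda>xs. xs @ [p]) ` C) = gf h t A + gf h t ((\<lambda>xs. xs @ [p]) ` C)"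
    using assms(3) by (intro gf_Un) fastforce
  finally show ?thesis
    by (simp only: gf_singleton gf_snoc[OF assms(2)])
qed

lemma gf_parts_ge:
  assumes "0 < v"
  shows "gf h t (parts_ge v) = gf h t (parts_ge_overlined v) +
    fps_const2 (fps_X ^ v) * x_var ^ t (v, False) * y_var * gf h t (parts_ge v) +
    fps_const2 (fps_X ^ v) * x_var ^ h (v, False) * y_var"
proof -
  have "[] \<notin> parts_ge v"
    by (simp add: parts_ge_def)
  moreover have "last xs \<noteq> (v, False)" if "xs \<in> parts_ge_overlined v" for xs
    using that last_in_set[of xs] by (force simp: parts_ge_overlined_def)
  ultimately show ?thesis
    by (rule gf_decompose[OF parts_ge_decompose[OF assms], unfolded fst_conv])
qed

lemma gf_parts_ge_overlined:
  assumes "0 < v"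
  shows "gf h t (parts_ge_overlined v) = gf h t (parts_ge (Suc v)) +
    fps_const2 (fps_X ^ v) * x_var ^ t (v, True) * y_var * gf h t (parts_ge (Suc v)) +
    fps_const2 (fps_X ^ v) * x_var ^ h (v, True) * y_var"
proof -
  have "[] \<notin> parts_ge (Suc v)"
    by (simp add: parts_ge_def)
  moreover have "last xs \<noteq> (v, True)" if "xs \<in> parts_ge (Suc v)" for xs
    using that last_in_set[of xs] by (force simp: parts_ge_def)
  ultimately show ?thesis
    by (rule gf_decompose[OF parts_ge_overlined_decompose[OF assms], unfolded fst_conv])
qed

section \<open>Lowering all parts by the same amount\<close>

definition shift :: "nat \<Rightarrow> part list \<Rightarrow> part list" where
  "shift d = map (\<lambda>(v, b). (v + d, b))"

lemma length_shift [simp]: "length (shift d xs) = length xs"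
  by (simp add: shift_def)

lemma inj_shift: "inj (shift d)"
  unfolding shift_def by (rule inj_mapI) (auto simp: inj_def)

lemma overpartition_shift:
  assumes "\<And>p. p \<in> set xs \<Longrightarrow> 0 < fst p"
  shows "overpartition (shift d xs) \<longleftrightarrow> overpartition xs"
  using assms
proof (induction xs rule: rev_induct)
  case Nil
  then show ?case by (simp add: shift_def)
next
  case (snoc p xs)
  then have "0 < fst p" "overpartition (shift d xs) \<longleftrightarrow> overpartition xs"
    by auto
  then show ?case
    by (auto simp: shift_def overpartition_snoc split: prod.splits)
qed

lemma parts_ge_shift: "parts_ge (Suc d) = shift d ` parts_ge 1"
proof (intro equalityI subsetI)
  fix xs assume xs: "xs \<in> parts_ge (Suc d)"
  define ys where "ys = map (\<lambda>(v, b). (v - d, b)) xs"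
  have "shift d ys = xs"
    using xs by (auto simp: shift_def ys_def parts_ge_def o_def split_def intro!: map_idI)
  moreover have pos: "\<forall>p\<in>set ys. 1 \<le> fst p"
    using xs by (fastforce simp: ys_def parts_ge_def)
  moreover have "overpartition ys"
    using xs calculation overpartition_shift[of ys d] by (auto simp: parts_ge_def Suc_le_eq)
  ultimately show "xs \<in> shift d ` parts_ge 1"
    using xs by (auto simp: parts_ge_def image_iff shift_def intro!: exI[of _ ys])
next
  fix xs assume "xs \<in> shift d ` parts_ge 1"
  then show "xs \<in> parts_ge (Suc d)"
    using overpartition_shift by (fastforce simp: parts_ge_def shift_def)
qed

text \<open>Raising \<open>l\<close> parts by \<open>d\<close> adds \<open>d * l\<close> to the
  weight, which dilates \<open>y\<close> by \<open>q^d\<close>. Only the contribution of the head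
  changes, by one, whence the factor \<open>x\<close>.\<close>

lemma gf_shift:
  assumes h: "\<And>v b. 1 \<le> v \<Longrightarrow> h (v + d, b) = Suc (h (v, b))" and t: "\<And>v b. t (v + d, b) = t (v, b)"
  shows "gf h t (parts_ge (Suc d)) = x_var * dilate (fps_const (fps_X ^ d)) (gf h t (parts_ge 1))"
proof (rule gf_eqI)
  fix l a n
  have stat: "stat h t (shift d xs) = Suc (stat h t xs)" if "xs \<in> parts_ge 1" for xs
    using that h t
    by (cases xs) (auto simp: stat_def shift_def parts_ge_def Suc_le_eq intro!: arg_cong[of _ _ sum_list])
  have wt: "weight (shift d xs) = weight xs + d * length xs" for xs
    by (induction xs) (auto simp: shift_def)
  have "card (cells h t (parts_ge (Suc d)) l a n) =
    (if 1 \<le> a \<and> d * l \<le> n then card (cells h t (parts_ge 1) l (a - 1) (n - d * l)) else 0)"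
  proof (cases "1 \<le> a \<and> d * l \<le> n")
    case True
    then have "cells h t (parts_ge (Suc d)) l a n =
        shift d ` cells h t (parts_ge 1) l (a - 1) (n - d * l)"
      unfolding parts_ge_shift using stat wt by (auto simp: cells_def)
    then show ?thesis
      using True by (simp add: card_image inj_on_subset[OF inj_shift])
  next
    case False
    then have "cells h t (parts_ge (Suc d)) l a n = {}"
      unfolding parts_ge_shift using stat wt by (auto simp: cells_def)
    then show ?thesis using False by auto
  qed
  then show "fps_nth (fps_nth (fps_nth (gf h t (parts_ge (Suc d))) l) a) n =
      fps_nth (fps_nth (fps_nth (x_var * dilate (fps_const (fps_X ^ d)) (gf h t (parts_ge 1))) l) a) n"
    by (simp add: gf_nth fps_const_power fps_X_power_mult_nth power_mult[symmetric])
qed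

text \<open>
  For the \<open>M\<^sub>2\<close>-rank a non-overlined odd part counts towards both exponents unless it is the first
  part. This is what \<open>chi\<close> amounts to, and it makes every coefficient of \<open>x^a y^l\<close> a polynomial.
\<close>

definition D_head :: "part \<Rightarrow> nat" where "D_head p = fst p"
definition D_tail :: "part \<Rightarrow> nat" where "D_tail p = 0"
definition M2_head :: "part \<Rightarrow> nat" where "M2_head p = (fst p + 1) div 2"
definition M2_tail :: "part \<Rightarrow> nat" where "M2_tail p = (if odd (fst p) \<and> \<not> snd p then 1 else 0)"


section \<open>The functional equations of the two ranks\<close>

lemma functional_eq_D: "functional_eq 0 fps_X (1 + gf D_head D_tail (parts_ge 1))"
proof -
  define G where "G v = gf D_head D_tail (parts_ge v)" for v
  define B where "B v = gf D_head D_tail (parts_ge_overlined v)" for v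
  define p :: "int fps fps fps" where "p = fps_const2 fps_X"
  define x :: "int fps fps fps" where "x = x_var"
  define y :: "int fps fps fps" where "y = y_var"
  define G' where "G' = dilate (fps_const fps_X) (G 1)"
  have 1: "G 1 = B 1 + p * y * G 1 + p * x * y"
    using gf_parts_ge[of 1 D_head D_tail]
    unfolding G_def B_def p_def x_def y_def by (simp add: D_head_def D_tail_def del: fps_const_mult)
  have 2: "B 1 = G 2 + p * y * G 2 + p * x * y"
    using gf_parts_ge_overlined[of 1 D_head D_tail]
    unfolding G_def B_def p_def x_def y_def
    by (simp add: D_head_def D_tail_def numeral_2_eq_2 del: fps_const_mult)
  have 3: "G 2 = x * G'"
    using gf_shift[of D_head 1 D_tail]
    unfolding G_def G'_def x_def by (simp add: D_head_def D_tail_def numeral_2_eq_2)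
  have "(1 - p * y) * G 1 = B 1 + p * x * y"
    using 1 by (simp add: algebra_simps)
  then have "(1 - p * y) * (1 + G 1) = (1 - x) * (1 - p * y) + x * (1 + y * p) * (1 + G')"
    unfolding 2 3 by (simp add: algebra_simps)
  then show ?thesis
    unfolding functional_eq_def G_def[symmetric] dilate_add dilate_one G'_def[symmetric]
      p_def[symmetric] x_def[symmetric] y_def[symmetric] by simp
qed

text \<open>Both values 1 and 2 are stripped, because lowering by 2 preserves parity and hence
  \<open>M2_tail\<close>. A non-overlined 1 in the tail carries an extra \<open>x\<close>, the
  source of the factor \<open>1 - x * y * a\<close>.\<close>

lemma functional_eq_M2: "functional_eq fps_X (fps_X\<^sup>2) (1 + gf M2_head M2_tail (parts_ge 1))"
proof -
  define G where "G v = gf M2_head M2_tail (parts_ge v)" for v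
  define B where "B v = gf M2_head M2_tail (parts_ge_overlined v)" for v
  define a :: "int fps fps fps" where "a = fps_const2 fps_X"
  define p :: "int fps fps fps" where "p = fps_const2 (fps_X\<^sup>2)"
  define x :: "int fps fps fps" where "x = x_var"
  define y :: "int fps fps fps" where "y = y_var"
  define G' where "G' = dilate (fps_const (fps_X\<^sup>2)) (G 1)"
  have 1: "G 1 = B 1 + a * x * y * G 1 + a * x * y"
    using gf_parts_ge[of 1 M2_head M2_tail]
    unfolding G_def B_def a_def x_def y_def by (simp add: M2_head_def M2_tail_def del: fps_const_mult)
  have 2: "B 1 = G 2 + a * y * G 2 + a * x * y"
    using gf_parts_ge_overlined[of 1 M2_head M2_tail]
    unfolding G_def B_def a_def x_def y_def
    by (simp add: M2_head_def M2_tail_def numeral_2_eq_2 del: fps_const_mult)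
  have 3: "G 2 = B 2 + p * y * G 2 + p * x * y"
    using gf_parts_ge[of 2 M2_head M2_tail]
    unfolding G_def B_def p_def x_def y_def by (simp add: M2_head_def M2_tail_def del: fps_const_mult)
  have 4: "B 2 = G 3 + p * y * G 3 + p * x * y"
    using gf_parts_ge_overlined[of 2 M2_head M2_tail]
    unfolding G_def B_def p_def x_def y_def
    by (simp add: M2_head_def M2_tail_def numeral_3_eq_3 del: fps_const_mult)
  have 5: "G 3 = x * G'"
    using gf_shift[of M2_head 2 M2_tail]
    unfolding G_def G'_def x_def by (simp add: M2_head_def M2_tail_def numeral_3_eq_3)
  have 6: "(1 - p * y) * G 2 = B 2 + p * x * y"
    using 3 by (simp add: algebra_simps)
  have "(1 - x * y * a) * G 1 = B 1 + a * x * y"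
    using 1 by (simp add: algebra_simps)
  then have "(1 - x * y * a) * (1 - p * y) * G 1 = (1 - p * y) * (B 1 + a * x * y)"
    by (simp add: mult_ac)
  also have "\<dots> = (1 + a * y) * ((1 - p * y) * G 2) + 2 * a * x * y * (1 - p * y)"
    unfolding 2 by (simp add: algebra_simps)
  finally have "(1 - x * y * a) * (1 - p * y) * (1 + G 1) =
      (1 - x) * (1 - p * y) + x * (1 + y * a) * (1 + y * p) * (1 + G')"
    unfolding 6 4 5 by (simp add: algebra_simps)
  then show ?thesis
    unfolding functional_eq_def G_def[symmetric] dilate_add dilate_one G'_def[symmetric]
      p_def[symmetric] x_def[symmetric] y_def[symmetric] a_def[symmetric] .
qed

section \<open>Rank counts as diagonal sums of coefficients\<close>

lemma card_rank_eq:
  fixes rank :: "part list \<Rightarrow> int"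
  assumes rank: "rank [] = 0" "\<And>xs. xs \<noteq> [] \<Longrightarrow> rank xs = int (stat h t xs) - int (length xs)"
    and "n \<le> L"
  shows "int (card {xs \<in> overpartitions_of (int n). rank xs = int m}) =
    (\<Sum>l\<le>L. fps_nth (fps_nth (fps_nth (1 + gf h t (parts_ge 1)) l) (l + m)) n)"
proof -
  let ?E = "if m = 0 \<and> n = 0 then {[]} else {} :: part list set"
  let ?C = "\<lambda>l. cells h t (parts_ge 1) l (l + m) n"
  \<comment> \<open>An overpartition of \<open>n\<close> has at most \<open>n\<close> parts, so the
    sum over lengths may stop at any \<open>L \<ge> n\<close>.\<close>
  have len: "length xs \<le> weight xs" if "overpartition xs" for xs
    using that by (induction xs rule: rev_induct) (auto simp: overpartition_snoc)
  have "{xs \<in> overpartitions_of (int n). rank xs = int m} = ?E \<union> (\<Union>l\<le>L. ?C l)"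
  proof (intro equalityI subsetI)
    fix xs assume xs: "xs \<in> {xs \<in> overpartitions_of (int n). rank xs = int m}"
    show "xs \<in> ?E \<union> (\<Union>l\<le>L. ?C l)"
    proof (cases "xs = []")
      case True
      then show ?thesis using xs rank by (auto simp: overpartitions_of_def)
    next
      case False
      have "\<forall>p\<in>set xs. 1 \<le> fst p"
        using xs by (auto simp: overpartitions_of_def overpartition_def Suc_le_eq)
      then have "xs \<in> ?C (length xs)"
        using False xs rank(2)[OF False]
        by (auto simp: cells_def parts_ge_def overpartitions_of_def)
      moreover have "length xs \<le> L"
        using xs len[of xs] \<open>n \<le> L\<close> by (auto simp: overpartitions_of_def)
      ultimately show ?thesis by blast
    qed
  next
    fix xs assume "xs \<in> ?E \<union> (\<Union>l\<le>L. ?C l)"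
    then show "xs \<in> {xs \<in> overpartitions_of (int n). rank xs = int m}"
      using rank by (auto simp: cells_def parts_ge_def overpartitions_of_def split: if_splits)
  qed
  also have "card \<dots> = card ?E + card (\<Union>l\<le>L. ?C l)"
    by (rule card_Un_disjoint) (auto simp: finite_cells, auto simp: cells_def parts_ge_def)
  also have "card (\<Union>l\<le>L. ?C l) = (\<Sum>l\<le>L. card (?C l))"
    by (rule card_UN_disjoint) (simp_all add: finite_cells, auto simp: cells_def)
  \<comment> \<open>The empty overpartition corresponds to the summand 1 of the series.\<close>
  also have "int (card ?E + (\<Sum>l\<le>L. card (?C l))) =
      (\<Sum>l\<le>L. fps_nth (fps_nth (fps_nth 1 l) (l + m)) n) + (\<Sum>l\<le>L. int (card (?C l)))"
  proof -
    have "(\<Sum>l\<le>L. fps_nth (fps_nth (fps_nth (1 :: int fps fps fps) l) (l + m)) n) =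
        (\<Sum>l\<in>{0}. fps_nth (fps_nth (fps_nth 1 l) (l + m)) n)"
      by (rule sum.mono_neutral_right) auto
    then show ?thesis by simp
  qed
  finally show ?thesis
    by (simp add: gf_nth sum.distrib)
qed

lemma N_bar_eq:
  assumes "n \<le> L"
  shows "int (N_bar (int m) (int n)) =
    (\<Sum>l\<le>L. fps_nth (fps_nth (fps_nth (1 + gf D_head D_tail (parts_ge 1)) l) (l + m)) n)"
  unfolding N_bar_def
  by (rule card_rank_eq)
    (use assms in \<open>auto simp: D_rank_def largest_part_def stat_def D_head_def D_tail_def\<close>)

lemma ceiling_half: "\<lceil>real k / 2\<rceil> = int ((k + 1) div 2)"
  by (cases "even k") (auto elim!: evenE oddE simp: ceiling_unique)

lemma N2_bar_eq:
  assumes "n \<le> L"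
  shows "int (N2_bar (int m) (int n)) =
    (\<Sum>l\<le>L. fps_nth (fps_nth (fps_nth (1 + gf M2_head M2_tail (parts_ge 1)) l) (l + m)) n)"
  unfolding N2_bar_def
proof (rule card_rank_eq)
  show "M2_rank [] = 0"
    by (simp add: M2_rank_def largest_part_def nonoverlined_odd_parts_def chi_def)
next
  fix xs :: "part list" assume "xs \<noteq> []"
  moreover have "int (length (nonoverlined_odd_parts ys)) = int (sum_list (map M2_tail ys))" for ys
    by (induction ys) (auto simp: nonoverlined_odd_parts_def M2_tail_def)
  ultimately show "M2_rank xs = int (stat M2_head M2_tail xs) - int (length xs)"
    unfolding M2_rank_def stat_def largest_part_def ceiling_half
    by (cases xs) (auto simp: chi_def M2_head_def M2_tail_def)
qed (rule assms)

subsection \<open>Nonnegativity\<close>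

text \<open>The predicate is mostly applied to a difference, \<open>nonneg (F - G)\<close>, as the
  coefficientwise order.\<close>

definition nonneg :: "int fps \<Rightarrow> bool" where
  "nonneg F \<longleftrightarrow> (\<forall>n. 0 \<le> fps_nth F n)"

lemma nonneg_0 [simp]: "nonneg 0" and nonneg_1 [simp]: "nonneg 1" and nonneg_2 [simp]: "nonneg 2"
  and nonneg_X [simp]: "nonneg fps_X"
  by (auto simp: nonneg_def fps_X_def fps_numeral_nth)

lemma nonneg_add: "nonneg F \<Longrightarrow> nonneg G \<Longrightarrow> nonneg (F + G)"
  by (simp add: nonneg_def)

lemma nonneg_mult: "nonneg F \<Longrightarrow> nonneg G \<Longrightarrow> nonneg (F * G)"
  by (simp add: nonneg_def fps_mult_nth sum_nonneg)

lemma nonneg_power: "nonneg F \<Longrightarrow> nonneg (F ^ n)"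
  by (induction n) (simp_all add: nonneg_mult)

lemma nonneg_sum: "(\<And>i. i \<in> A \<Longrightarrow> nonneg (f i)) \<Longrightarrow> nonneg (\<Sum>i\<in>A. f i)"
  by (simp add: nonneg_def fps_sum_nth sum_nonneg)

lemma nonneg_prod: "(\<And>i. i \<in> A \<Longrightarrow> nonneg (f i)) \<Longrightarrow> nonneg (\<Prod>i\<in>A. f i)"
  by (induction A rule: infinite_finite_induct) (simp_all add: nonneg_mult)

lemmas nonneg_intros = nonneg_add nonneg_mult nonneg_power nonneg_sum nonneg_prod

lemma nonneg_mult_diff:
  assumes "nonneg (A - A')" "nonneg (B - B')" "nonneg A'" "nonneg B"
  shows "nonneg (A * B - A' * B')"
proof -
  have "A * B - A' * B' = (A - A') * B + A' * (B - B')"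
    by (simp add: algebra_simps)
  then show ?thesis
    using assms by (simp add: nonneg_intros)
qed

definition nonneg_coeffs :: "int fps fps \<Rightarrow> bool" where
  "nonneg_coeffs F \<longleftrightarrow> (\<forall>n. nonneg (fps_nth F n))"

lemma nonneg_coeffs_mult: "nonneg_coeffs F \<Longrightarrow> nonneg_coeffs G \<Longrightarrow> nonneg_coeffs (F * G)"
  by (simp add: nonneg_coeffs_def fps_mult_nth nonneg_intros)

lemma nonneg_coeffs_geo: "nonneg c \<Longrightarrow> nonneg_coeffs (geo c)"
  by (simp add: nonneg_coeffs_def nonneg_power)

lemma nonneg_coeffs_prod: "(\<And>i. i \<in> A \<Longrightarrow> nonneg_coeffs (f i)) \<Longrightarrow> nonneg_coeffs (\<Prod>i\<in>A. f i)"
proof (induction A rule: infinite_finite_induct)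
  case (insert x F)
  then show ?case by (simp add: nonneg_coeffs_mult)
qed (simp_all add: nonneg_coeffs_def)

text \<open>All summands of the Cauchy product but one are dropped.\<close>

lemma mult_nth_ge:
  assumes "nonneg_coeffs F" "nonneg_coeffs G"
  shows "nonneg (fps_nth (F * G) (i + j) - fps_nth F i * fps_nth G j)"
proof -
  have "fps_nth (F * G) (i + j) =
      fps_nth F i * fps_nth G j + (\<Sum>k\<in>{0..i + j} - {i}. fps_nth F k * fps_nth G (i + j - k))"
    by (subst fps_mult_nth, subst sum.remove[of _ i]) auto
  then show ?thesis
    using assms by (auto simp: nonneg_coeffs_def intro!: nonneg_intros)
qed

text \<open>Here \<open>\<psi>\<close> is \<open>(1 - p^2) / (1 - q)\<close>, and \<open>d\<close>
  is its cofactor in \<open>c_2\<close>; thus \<open>\<psi>\<close> divides \<open>c_k\<close> for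
  every \<open>k \<ge> 2\<close>.\<close>

locale rank_series =
  fixes \<alpha> p \<psi> d :: "int fps"
  assumes nonneg_\<alpha>: "nonneg \<alpha>" and nonneg_p: "nonneg p" and nonneg_d: "nonneg d"
    and nonneg_\<psi>: "nonneg (\<psi> - 1)" and \<psi>: "(1 - fps_X) * \<psi> = 1 - p\<^sup>2"
    and term_coeff_2: "term_coeff \<alpha> p 2 = \<psi> * d"
begin

definition h :: "nat \<Rightarrow> nat \<Rightarrow> int fps" where
  "h k j = fps_nth (qpoch_inv p k) j"

text \<open>
  \<open>diag k m J\<close> is a truncation of the coefficient of \<open>z^m\<close> in \<open>1 / ((zp;p)\<^sub>k (p/z;p)\<^sub>k)\<close>. The
  truncated sums in \<open>step\<close> have different lengths so that the excess term is nonnegative.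
\<close>

definition diag :: "nat \<Rightarrow> nat \<Rightarrow> nat \<Rightarrow> int fps" where
  "diag k m J = (\<Sum>j<J. h k (j + m) * h k j)"

definition step :: "nat \<Rightarrow> nat \<Rightarrow> nat \<Rightarrow> int fps" where
  "step k m J = term_coeff \<alpha> p k * (diag k m (Suc J) - fps_X * diag k m J)"

text \<open>The factor \<open>(xy)^k\<close> shifts both exponents by \<open>k\<close>; with
  \<open>l = j + k\<close> the indices \<open>j \<le> L - k\<close> remain.\<close>

lemma diagonal_eq:
  assumes "functional_eq \<alpha> p F"
  shows "(\<Sum>l\<le>L. fps_nth (fps_nth F l) (l + m)) =
    (\<Sum>k\<le>L. term_coeff \<alpha> p k * diag k m (Suc L - k))"
proof -
  have "(\<Sum>l\<le>L. fps_nth (fps_nth F l) (l + m)) =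
      (\<Sum>l\<le>L. \<Sum>k\<le>L. fps_nth (fps_nth (rank_term \<alpha> p k) l) (l + m))"
    by (intro sum.cong refl functional_eq_nth[OF assms]) simp
  also have "\<dots> = (\<Sum>k\<le>L. \<Sum>l\<le>L. fps_nth (fps_nth (rank_term \<alpha> p k) l) (l + m))"
    by (rule sum.swap)
  also have "\<dots> = (\<Sum>k\<le>L. term_coeff \<alpha> p k * diag k m (Suc L - k))"
  proof (intro sum.cong refl)
    fix k assume "k \<in> {..L}"
    then have k: "k \<le> L" by simp
    have "(\<Sum>l\<le>L. fps_nth (fps_nth (rank_term \<alpha> p k) l) (l + m)) =
        (\<Sum>l\<in>{k..L}. term_coeff \<alpha> p k * h k (l + m - k) * h k (l - k))"
      by (intro sum.mono_neutral_cong_right) (auto simp: rank_term_nth h_def)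
    also have "\<dots> = (\<Sum>j<Suc L - k. term_coeff \<alpha> p k * (h k (j + m) * h k j))"
      by (rule sum.reindex_bij_witness[of _ "\<lambda>j. j + k" "\<lambda>l. l - k"]) (use k in \<open>auto simp: mult_ac\<close>)
    finally show "(\<Sum>l\<le>L. fps_nth (fps_nth (rank_term \<alpha> p k) l) (l + m)) =
        term_coeff \<alpha> p k * diag k m (Suc L - k)"
      by (simp add: diag_def sum_distrib_left)
  qed
  finally show ?thesis .
qed

lemma diagonal_diff:
  assumes "functional_eq \<alpha> p F"
  shows "(\<Sum>l\<le>Suc L. fps_nth (fps_nth (fps_nth F l) (l + m)) (Suc L)) -
      (\<Sum>l\<le>L. fps_nth (fps_nth (fps_nth F l) (l + m)) L) =
    (\<Sum>k\<le>Suc L. fps_nth (step k m (Suc L - k)) (Suc L))"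
proof -
  have "(\<Sum>l\<le>Suc L. fps_nth (fps_nth (fps_nth F l) (l + m)) (Suc L)) -
      (\<Sum>l\<le>L. fps_nth (fps_nth (fps_nth F l) (l + m)) L) =
    fps_nth ((\<Sum>l\<le>Suc L. fps_nth (fps_nth F l) (l + m)) -
      fps_X * (\<Sum>l\<le>L. fps_nth (fps_nth F l) (l + m))) (Suc L)"
    by (simp add: fps_sum_nth del: sum.atMost_Suc)
  \<comment> \<open>The added term \<open>k = Suc L\<close> vanishes because its \<open>diag\<close>
    is an empty sum.\<close>
  also have "(\<Sum>l\<le>L. fps_nth (fps_nth F l) (l + m)) =
      (\<Sum>k\<le>Suc L. term_coeff \<alpha> p k * diag k m (Suc L - k))"
    unfolding diagonal_eq[OF assms] by (simp add: diag_def)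
  also have "(\<Sum>l\<le>Suc L. fps_nth (fps_nth F l) (l + m)) -
      fps_X * (\<Sum>k\<le>Suc L. term_coeff \<alpha> p k * diag k m (Suc L - k)) =
      (\<Sum>k\<le>Suc L. step k m (Suc L - k))"
    unfolding diagonal_eq[OF assms] sum_distrib_left sum_subtractf[symmetric]
    by (intro sum.cong refl) (simp add: step_def Suc_diff_le algebra_simps)
  finally show ?thesis
    by (simp add: fps_sum_nth del: sum.atMost_Suc)
qed

section \<open>Cancelling parts of size 1 against \<open>1 - p^2\<close>\<close>

definition rest :: "nat \<Rightarrow> int fps fps" where
  "rest k = (\<Prod>i=2..k. geo (p ^ i))"

lemma nonneg_coeffs_rest: "nonneg_coeffs (rest k)"
  unfolding rest_def by (intro nonneg_coeffs_prod nonneg_coeffs_geo nonneg_power nonneg_p)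

lemma nonneg_coeffs_qpoch_inv: "nonneg_coeffs (qpoch_inv p k)"
  unfolding qpoch_inv_def by (intro nonneg_coeffs_prod nonneg_coeffs_geo nonneg_power nonneg_p)

lemma nonneg_h: "nonneg (h k j)"
  using nonneg_coeffs_qpoch_inv by (simp add: h_def nonneg_coeffs_def)

lemma nonneg_rest: "nonneg (fps_nth (rest k) j)"
  using nonneg_coeffs_rest by (simp add: nonneg_coeffs_def)

lemma qpoch_inv_eq_rest:
  assumes "1 \<le> k"
  shows "qpoch_inv p k = geo p * rest k"
proof -
  have "qpoch_inv p k = geo (p ^ 1) * (\<Prod>i\<in>{1..k} - {1}. geo (p ^ i))"
    unfolding qpoch_inv_def by (rule prod.remove) (use assms in auto)
  also have "{1..k} - {1} = {2..k}"
    by auto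
  finally show ?thesis
    by (simp add: rest_def)
qed

text \<open>A partition either contains a part 1, whose removal gives \<open>p * h k j\<close>, or
  is counted by \<open>rest k\<close>, which has only the part sizes \<open>2..k\<close>.\<close>

lemma h_Suc:
  assumes "1 \<le> k"
  shows "h k (Suc j) = p * h k j + fps_nth (rest k) (Suc j)"
proof -
  have "(1 - fps_const p * fps_X) * qpoch_inv p k = rest k"
    unfolding qpoch_inv_eq_rest[OF assms] mult.assoc[symmetric] one_minus_mult_geo by simp
  then have "fps_nth ((1 - fps_const p * fps_X) * qpoch_inv p k) (Suc j) = fps_nth (rest k) (Suc j)"
    by simp
  then show ?thesis
    by (simp add: h_def left_diff_distrib mult.assoc diff_eq_eq add.commute)
qed

text \<open>Subtracting the \<open>p^2\<close> term leaves the pairs of partitions that do not both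
  contain a 1. Those whose second member has no 1 form the last product; in the others only the
  second member has one.\<close>

lemma nonneg_diff_h_mult:
  assumes "1 \<le> k"
  shows "nonneg (h k (Suc j + m) * h k (Suc j) - p\<^sup>2 * (h k (j + m) * h k j) -
      h k (Suc j + m) * fps_nth (rest k) (Suc j))"
proof -
  have "h k (Suc j + m) * h k (Suc j) - p\<^sup>2 * (h k (j + m) * h k j) -
      h k (Suc j + m) * fps_nth (rest k) (Suc j) = fps_nth (rest k) (Suc j + m) * p * h k j"
    using h_Suc[OF assms, of j] h_Suc[OF assms, of "j + m"]
    by (simp add: algebra_simps power2_eq_square)
  then show ?thesis
    by (simp add: nonneg_intros nonneg_rest nonneg_h nonneg_p)
qed

lemma nonneg_diff_h_mult':
  assumes "1 \<le> k"
  shows "nonneg (h k (Suc j + m) * h k (Suc j) - p\<^sup>2 * (h k (j + m) * h k j))"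
  using nonneg_add[OF nonneg_diff_h_mult[OF assms, of j m]
      nonneg_mult[OF nonneg_h[of k "Suc j + m"] nonneg_rest[of k "Suc j"]]] by simp

text \<open>A truncation of \<open>1 - p^2\<close> times the diagonal sum; it enumerates pairs of
  partitions not both containing a part 1.\<close>

definition core :: "nat \<Rightarrow> nat \<Rightarrow> nat \<Rightarrow> int fps" where
  "core k m J = diag k m (Suc J) - p\<^sup>2 * diag k m J"

lemma core_eq:
  "core k m J = h k m * h k 0 +
    (\<Sum>j<J. h k (Suc j + m) * h k (Suc j) - p\<^sup>2 * (h k (j + m) * h k j))"
  unfolding core_def diag_def sum.lessThan_Suc_shift
  by (simp add: sum_subtractf sum_distrib_left)

lemma nonneg_core_diff_0:
  assumes "1 \<le> k"
  shows "nonneg (core k m J - h k m * h k 0)"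
proof -
  show ?thesis
    unfolding core_eq using nonneg_diff_h_mult'[OF assms] by (simp add: nonneg_sum)
qed

text \<open>Only the pairs whose second partition has \<open>Suc i\<close> parts, none equal to 1,
  are kept.\<close>

lemma nonneg_core_diff_Suc:
  assumes "1 \<le> k" "i < J"
  shows "nonneg (core k m J - h k (Suc i + m) * fps_nth (rest k) (Suc i))"
proof -
  let ?f = "\<lambda>j. h k (Suc j + m) * h k (Suc j) - p\<^sup>2 * (h k (j + m) * h k j)"
  have "core k m J - h k (Suc i + m) * fps_nth (rest k) (Suc i) =
      h k m * h k 0 + (?f i - h k (Suc i + m) * fps_nth (rest k) (Suc i)) + (\<Sum>j\<in>{..<J} - {i}. ?f j)"
    unfolding core_eq using assms(2) by (subst sum.remove[of _ i]) simp_all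
  then show ?thesis
    using nonneg_diff_h_mult[OF assms(1), of i m] nonneg_diff_h_mult'[OF assms(1)]
    by (simp only:) (intro nonneg_intros nonneg_h)
qed

lemma nonneg_core: "1 \<le> k \<Longrightarrow> nonneg (core k m J)"
  using nonneg_add[OF nonneg_core_diff_0[of k m J] nonneg_mult[OF nonneg_h[of k m] nonneg_h[of k 0]]]
  by simp

lemma h_0 [simp]: "h k 0 = 1"
  by (induction k) (simp_all add: h_def qpoch_inv_Suc)

text \<open>The bound comes from the pair of partitions \<open>2 1^(m-1)\<close> and the empty one.\<close>

lemma core_2_ge:
  assumes "1 \<le> m"
  shows "nonneg (core 2 m J - p ^ Suc m)"
proof -
  have "rest 2 = geo (p\<^sup>2)"
    by (simp add: rest_def)
  then have "qpoch_inv p 2 = geo p * geo (p\<^sup>2)"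
    by (simp add: qpoch_inv_eq_rest)
  then have "nonneg (h 2 m - p ^ (m - 1) * p\<^sup>2)"
    using mult_nth_ge[of "geo p" "geo (p\<^sup>2)" "m - 1" 1] assms
    by (simp add: h_def nonneg_coeffs_geo nonneg_p nonneg_power)
  moreover have "p ^ (m - 1) * p\<^sup>2 = p ^ Suc m"
    using assms by (simp flip: power_add)
  ultimately show ?thesis
    using nonneg_add[OF nonneg_core_diff_0[of 2 m J]] by fastforce
qed

text \<open>The bound comes from the pair of partitions \<open>2^i 1^m\<close> and \<open>2^i\<close>.\<close>

lemma core_3_ge:
  assumes "i \<le> J"
  shows "nonneg (core 3 m J - p ^ (m + 4 * i))"
proof -
  have rest3: "rest 3 = geo (p\<^sup>2) * geo (p ^ 3)"
    by (simp add: rest_def numeral_3_eq_3 numeral_2_eq_2)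
  have rest: "nonneg (fps_nth (rest 3) i - p ^ (2 * i))" for i
    using mult_nth_ge[of "geo (p\<^sup>2)" "geo (p ^ 3)" i 0]
    by (simp add: rest3 nonneg_coeffs_geo nonneg_p nonneg_power power_mult)
  have h: "nonneg (h 3 (i + m) - p ^ m * p ^ (2 * i))" for i
  proof -
    have "nonneg (h 3 (m + i) - p ^ m * fps_nth (rest 3) i)"
      using mult_nth_ge[of "geo p" "rest 3" m i]
      by (simp add: h_def qpoch_inv_eq_rest nonneg_coeffs_geo nonneg_p nonneg_coeffs_rest)
    from nonneg_add[OF this nonneg_mult[OF nonneg_power[OF nonneg_p, of m] rest[of i]]]
    show ?thesis by (simp add: algebra_simps)
  qed
  show ?thesis
  proof (cases i)
    case 0
    then show ?thesis
      using nonneg_add[OF nonneg_core_diff_0[of 3 m J] h[of 0]] by simp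
  next
    case (Suc r)
    have "nonneg (h 3 (i + m) * fps_nth (rest 3) i - p ^ m * p ^ (2 * i) * p ^ (2 * i))"
      by (intro nonneg_mult_diff h rest nonneg_intros nonneg_p nonneg_rest)
    moreover have "p ^ m * p ^ (2 * i) * p ^ (2 * i) = p ^ (m + 4 * i)"
      by (simp add: add.commute flip: power_add)
    moreover have "nonneg (core 3 m J - h 3 (i + m) * fps_nth (rest 3) i)"
      using nonneg_core_diff_Suc[of 3 r J m] assms Suc by simp
    ultimately show ?thesis
      using nonneg_add[of "core 3 m J - h 3 (i + m) * fps_nth (rest 3) i"] by fastforce
  qed
qed

text \<open>The quotient of \<open>c_k\<close> by \<open>\<psi>\<close> for
  \<open>k \<ge> 2\<close>.\<close>

definition reduced :: "nat \<Rightarrow> int fps" where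
  "reduced k = d * (\<Prod>i=2..<k. (1 + p ^ i) * (\<alpha> + p * p ^ i))"

lemma nonneg_reduced: "nonneg (reduced k)"
  unfolding reduced_def by (intro nonneg_intros nonneg_d nonneg_p nonneg_\<alpha> nonneg_1)

lemma term_coeff_eq_reduced:
  assumes "2 \<le> k"
  shows "term_coeff \<alpha> p k = \<psi> * reduced k"
proof -
  have "term_coeff \<alpha> p k = term_coeff \<alpha> p 2 * (\<Prod>i=2..<k. (1 + p ^ i) * (\<alpha> + p * p ^ i))"
    unfolding term_coeff_def lessThan_atLeast0
    by (rule prod.atLeastLessThan_concat[symmetric]) (use assms in auto)
  then show ?thesis
    by (simp add: term_coeff_2 reduced_def mult_ac)
qed

text \<open>The factor \<open>\<psi>\<close> of \<open>c_k\<close> turns \<open>1 - q\<close> into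
  \<open>1 - p^2\<close>. The top summand of the longer \<open>diag\<close> is multiplied by
  \<open>\<psi>\<close> instead of 1, an excess governed by \<open>\<psi> - 1\<close>.\<close>

lemma step_ge_core:
  assumes "2 \<le> k"
  shows "nonneg (step k m J - reduced k * core k m J)"
proof -
  have diag: "diag k m (Suc J) = diag k m J + h k (J + m) * h k J"
    by (simp add: diag_def)
  have "step k m J = reduced k * (((1 - fps_X) * \<psi>) * diag k m J + \<psi> * (h k (J + m) * h k J))"
    unfolding step_def term_coeff_eq_reduced[OF assms] diag by (simp add: algebra_simps)
  also have "\<dots> = reduced k * core k m J + reduced k * (\<psi> - 1) * (h k (J + m) * h k J)"
    unfolding \<psi> core_def diag by (simp add: algebra_simps)
  finally show ?thesis
    by (simp add: nonneg_intros nonneg_reduced nonneg_\<psi> nonneg_h)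
qed

lemma nonneg_step: "2 \<le> k \<Longrightarrow> nonneg (step k m J)"
  using nonneg_add[OF step_ge_core[of k m J] nonneg_mult[OF nonneg_reduced[of k] nonneg_core[of k m J]]]
  by simp

lemma step_ge:
  assumes "2 \<le> k" "nonneg (reduced k - e)" "nonneg (core k m J - f)" "nonneg e"
  shows "nonneg (step k m J - e * f)"
proof -
  have "nonneg (reduced k * core k m J - e * f)"
    using assms by (intro nonneg_mult_diff nonneg_core) auto
  then show ?thesis
    using nonneg_add[OF step_ge_core[OF assms(1), of m J]] by fastforce
qed

section \<open>The terms with \<open>k = 0\<close> and \<open>k = 1\<close>, and the criterion for
  monotonicity\<close>

lemma diag_0: "diag 0 m J = (if m = 0 \<and> 0 < J then 1 else 0)"
proof -
  have "diag 0 m J = (\<Sum>j<J. if j = 0 then (if m = 0 then 1 else 0) else 0)"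
    unfolding diag_def by (intro sum.cong) (auto simp: h_def)
  then show ?thesis by auto
qed

text \<open>The \<open>k = 0\<close> step is a polynomial in \<open>q\<close> of degree at most 1,
  so only the passage from \<open>n = 0\<close> to \<open>n = 1\<close> needs separate
  treatment.\<close>

lemma step_0_nth: "2 \<le> n \<Longrightarrow> fps_nth (step 0 m J) n = 0"
  by (simp add: step_def term_coeff_def diag_0 fps_X_def)

lemma diag_1: "diag 1 m J = (\<Sum>j<J. p ^ (m + 2 * j))"
  unfolding diag_def
  by (intro sum.cong refl) (simp add: h_def qpoch_inv_def mult_2 add_ac flip: power_add)

text \<open>Since the steps with \<open>k \<ge> 2\<close> are nonnegative and \<open>k = 0\<close>
  contributes nothing, a deficit can come only from \<open>k = 1\<close>, and a single later term
  suffices to cover it.\<close>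

lemma diagonal_mono:
  assumes "functional_eq \<alpha> p F" "2 \<le> n"
    and "0 \<le> fps_nth (step 1 m (n - 1)) n \<or>
      (\<exists>k\<in>{2..n}. 0 \<le> fps_nth (step 1 m (n - 1)) n + fps_nth (step k m (n - k)) n)"
  shows "(\<Sum>l\<le>n - 1. fps_nth (fps_nth (fps_nth F l) (l + m)) (n - 1)) \<le>
    (\<Sum>l\<le>n. fps_nth (fps_nth (fps_nth F l) (l + m)) n)"
proof -
  let ?s = "\<lambda>k. fps_nth (step k m (n - k)) n"
  have pos: "0 \<le> ?s k" if "2 \<le> k" for k
    using nonneg_step[OF that] by (simp add: nonneg_def)
  have "(\<Sum>k\<le>n. ?s k) = ?s 0 + (?s 1 + (\<Sum>k\<in>{2..n}. ?s k))"
  proof -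
    have "{..n} = insert 0 (insert 1 {2..n})"
      using assms(2) by auto
    then show ?thesis by simp
  qed
  moreover have "?s 0 = 0"
    using step_0_nth[OF assms(2)] .
  moreover have "0 \<le> ?s 1 + (\<Sum>k\<in>{2..n}. ?s k)"
    using assms(3)
  proof
    assume "0 \<le> fps_nth (step 1 m (n - 1)) n"
    then show ?thesis
      using sum_nonneg[of "{2..n}" ?s] pos by auto
  next
    assume "\<exists>k\<in>{2..n}. 0 \<le> fps_nth (step 1 m (n - 1)) n + ?s k"
    then obtain k where k: "k \<in> {2..n}" "0 \<le> ?s 1 + ?s k"
      by auto
    moreover have "?s k \<le> (\<Sum>k\<in>{2..n}. ?s k)"
      using k(1) pos by (intro member_le_sum) auto
    ultimately show ?thesis by simp
  qed
  moreover have "(\<Sum>l\<le>n. fps_nth (fps_nth (fps_nth F l) (l + m)) n) -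
      (\<Sum>l\<le>n - 1. fps_nth (fps_nth (fps_nth F l) (l + m)) (n - 1)) = (\<Sum>k\<le>n. ?s k)"
    using diagonal_diff[OF assms(1), where L = "n - 1" and m = m] assms(2)
    by (simp del: sum.atMost_Suc)
  ultimately show ?thesis by linarith
qed

text \<open>For \<open>m = 0\<close> the step \<open>k = 0\<close> contributes -1, which the
  coefficient of at least 2 from \<open>k = 1\<close> outweighs.\<close>

lemma diagonal_mono_1:
  assumes "functional_eq \<alpha> p F" and "2 \<le> fps_nth (term_coeff \<alpha> p 1) 1"
  shows "fps_nth (fps_nth (fps_nth F 0) m) 0 \<le> (\<Sum>l\<le>1. fps_nth (fps_nth (fps_nth F l) (l + m)) 1)"
proof -
  have "step 1 m 0 = term_coeff \<alpha> p 1 * p ^ m"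
    unfolding step_def diag_1 by simp
  moreover have "nonneg (term_coeff \<alpha> p 1 * p ^ m)"
    unfolding term_coeff_def by (intro nonneg_intros nonneg_1 nonneg_p nonneg_\<alpha>)
  then have "0 \<le> fps_nth (term_coeff \<alpha> p 1 * p ^ m) 1"
    by (simp only: nonneg_def)
  moreover have "fps_nth (step 0 m 1) 1 = (if m = 0 then - 1 else 0)"
    by (simp add: step_def term_coeff_def diag_0)
  ultimately show ?thesis
    using diagonal_diff[OF assms(1), where L = 0 and m = m] assms(2) by (cases "m = 0") auto
qed

end

section \<open>The two instances: negative coefficients and the terms that compensate them\<close>

abbreviation q :: "int fps" where "q \<equiv> fps_X"

interpretation D: rank_series 0 fps_X "1 + fps_X" "2 * fps_X ^ 3"
proof
  show "term_coeff 0 q 2 = (1 + q) * (2 * q ^ 3)"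
    by (simp add: term_coeff_def numeral_2_eq_2 numeral_3_eq_3)
qed (simp_all add: nonneg_intros power2_eq_square algebra_simps)

interpretation M2: rank_series fps_X "fps_X\<^sup>2" "(1 + fps_X) * (1 + fps_X\<^sup>2)" "2 * fps_X\<^sup>2 * (1 + fps_X ^ 3)"
proof
  show "term_coeff q (q\<^sup>2) 2 = (1 + q) * (1 + q\<^sup>2) * (2 * q\<^sup>2 * (1 + q ^ 3))"
    by (simp add: term_coeff_def numeral_2_eq_2 numeral_3_eq_3 algebra_simps)
  have "(1 + q) * (1 + q\<^sup>2) - 1 = q + q\<^sup>2 + q * q\<^sup>2"
    by (simp add: algebra_simps)
  then show "nonneg ((1 + q) * (1 + q\<^sup>2) - 1)"
    by (simp add: nonneg_intros)
qed (simp_all add: nonneg_intros power2_eq_square algebra_simps)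

lemma nonneg_diff_nthD: "nonneg (F - G) \<Longrightarrow> fps_nth G n \<le> fps_nth F n"
  by (simp add: nonneg_def)

lemma D_term_coeff_1: "term_coeff 0 q 1 = 2 * q"
  by (simp add: term_coeff_def)

lemma M2_term_coeff_1: "term_coeff q (q\<^sup>2) 1 = 2 * q * (1 + q)"
  by (simp add: term_coeff_def power2_eq_square algebra_simps)

lemma sum_le_1_if_inj:
  assumes "finite A" "inj_on f A"
  shows "(\<Sum>j\<in>A. if n = f j then 1 else 0 :: int) \<le> (if \<exists>j\<in>A. n = f j then 1 else 0)"
proof (cases "\<exists>j\<in>A. n = f j")
  case True
  then obtain i where i: "i \<in> A" "n = f i" by auto
  have "(\<Sum>j\<in>A. if n = f j then 1 else 0 :: int) = (\<Sum>j\<in>A. if j = i then 1 else 0)"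
    using i assms(2) by (intro sum.cong refl) (auto simp: inj_on_def)
  then show ?thesis using i assms(1) by auto
qed (auto intro!: sum_nonpos)

text \<open>As \<open>c_1 = 2q\<close>, the negative part is \<open>2 q^2\<close> times
  \<open>diag\<close>, whose exponents \<open>m + 2 + 2j\<close> are distinct.\<close>

lemma D_step_1:
  "fps_nth (D.step 1 m J) n \<ge> (if \<exists>j. n = m + 2 + 2 * j then - 2 else 0)"
proof -
  have "D.step 1 m J + 2 * q\<^sup>2 * D.diag 1 m J = 2 * q * D.diag 1 m (Suc J)"
    unfolding D.step_def D_term_coeff_1 by (simp add: algebra_simps power2_eq_square)
  moreover have "nonneg (2 * q * D.diag 1 m (Suc J))"
    unfolding D.diag_1 by (intro nonneg_intros) simp_all
  ultimately have "0 \<le> fps_nth (D.step 1 m J + 2 * q\<^sup>2 * D.diag 1 m J) n"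
    by (simp add: nonneg_def)
  moreover have "2 * q\<^sup>2 * D.diag 1 m J = fps_const 2 * (\<Sum>j<J. q ^ (m + 2 + 2 * j))"
    unfolding D.diag_1 mult.assoc sum_distrib_left by (simp add: power_add mult_ac numeral_fps_const power2_eq_square)
  then have "fps_nth (2 * q\<^sup>2 * D.diag 1 m J) n = 2 * (\<Sum>j<J. if n = m + 2 + 2 * j then 1 else 0)"
    by (simp add: fps_sum_nth del: power_Suc)
  moreover have "(\<Sum>j<J. if n = m + 2 + 2 * j then 1 else 0 :: int) \<le>
      (if \<exists>j\<in>{..<J}. n = m + 2 + 2 * j then 1 else 0)"
    by (rule sum_le_1_if_inj) (auto simp: inj_on_def)
  ultimately show ?thesis by (auto split: if_splits)
qed

text \<open>Here \<open>(1 - q) c_1 = 2q - 2q^3\<close>, so the negative part has the distinct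
  exponents \<open>2m + 3 + 4j\<close>.\<close>

lemma M2_step_1:
  "fps_nth (M2.step 1 m J) n \<ge> (if \<exists>j. n = 2 * m + 3 + 4 * j then - 2 else 0)"
proof -
  have "M2.diag 1 m (Suc J) = M2.diag 1 m J + (q\<^sup>2) ^ (m + 2 * J)"
    unfolding M2.diag_1 by simp
  then have "M2.step 1 m J + 2 * q ^ 3 * M2.diag 1 m J =
      2 * q * (M2.diag 1 m J + (1 + q) * (q\<^sup>2) ^ (m + 2 * J))"
    unfolding M2.step_def M2_term_coeff_1 by (simp add: algebra_simps power2_eq_square power3_eq_cube)
  moreover have "nonneg (2 * q * (M2.diag 1 m J + (1 + q) * (q\<^sup>2) ^ (m + 2 * J)))"
    unfolding M2.diag_1 by (intro nonneg_intros) simp_all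
  ultimately have "0 \<le> fps_nth (M2.step 1 m J + 2 * q ^ 3 * M2.diag 1 m J) n"
    by (simp add: nonneg_def)
  moreover have "2 * q ^ 3 * M2.diag 1 m J = fps_const 2 * (\<Sum>j<J. q ^ (2 * m + 3 + 4 * j))"
    unfolding M2.diag_1 mult.assoc sum_distrib_left
    by (simp add: power_add mult_ac numeral_fps_const flip: power_mult)
  then have "fps_nth (2 * q ^ 3 * M2.diag 1 m J) n = 2 * (\<Sum>j<J. if n = 2 * m + 3 + 4 * j then 1 else 0)"
    by (simp add: fps_sum_nth)
  moreover have "(\<Sum>j<J. if n = 2 * m + 3 + 4 * j then 1 else 0 :: int) \<le>
      (if \<exists>j\<in>{..<J}. n = 2 * m + 3 + 4 * j then 1 else 0)"
    by (rule sum_le_1_if_inj) (auto simp: inj_on_def)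
  ultimately show ?thesis by (auto split: if_splits)
qed

lemma two_X_power_mult_nth:
  "fps_nth (2 * fps_X ^ a * fps_X ^ b :: int fps) n = (if n = a + b then 2 else 0)"
proof -
  have "(2 * fps_X ^ a * fps_X ^ b :: int fps) = fps_const 2 * fps_X ^ (a + b)"
    by (simp add: power_add mult_ac numeral_fps_const)
  then show ?thesis by simp
qed

text \<open>The coefficient comes from \<open>2 q^3\<close>, the value of \<open>reduced 2\<close>,
  times \<open>q^(m+1)\<close> from \<open>core_2_ge\<close>. The case \<open>m = 0\<close> left out
  here is the exceptional pair \<open>(0, 4)\<close>.\<close>

lemma D_step_2:
  assumes "1 \<le> m"
  shows "2 \<le> fps_nth (D.step 2 m J) (m + 4)"
proof -
  have "nonneg (D.step 2 m J - 2 * q ^ 3 * q ^ Suc m)"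
    by (rule D.step_ge[OF _ _ D.core_2_ge[OF assms]]) (simp_all add: D.reduced_def nonneg_intros)
  from nonneg_diff_nthD[OF this, of "m + 4"] show ?thesis
    unfolding two_X_power_mult_nth by simp
qed

lemma atLeastLessThan_2_3: "{2..<3::nat} = {2}"
  by auto

lemma D_step_3:
  assumes "n = m + 6 + 2 * j" "j \<le> J"
  shows "2 \<le> fps_nth (D.step 3 m J) n"
proof -
  have red: "D.reduced 3 = 2 * q ^ 6 + 2 * q ^ 8"
    unfolding D.reduced_def atLeastLessThan_2_3 by (simp add: algebra_simps eval_nat_numeral)
  \<comment> \<open>The terms \<open>2 q^6\<close> and \<open>2 q^8\<close> of
    \<open>reduced 3\<close>, multiplied by \<open>q^(m + 4i)\<close> with
    \<open>i = j div 2\<close>, reach all exponents \<open>m + 6 + 2j\<close>; the parity of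
    \<open>j\<close> selects the term.\<close>
  define e where "e = (if even j then 6 else 8 :: nat)"
  have "nonneg (D.step 3 m J - 2 * q ^ e * q ^ (m + 4 * (j div 2)))"
    by (rule D.step_ge[OF _ _ D.core_3_ge]) (use assms in \<open>auto simp: red e_def nonneg_intros\<close>)
  moreover have "n = e + (m + 4 * (j div 2))"
    using assms(1) by (auto simp: e_def elim!: oddE)
  ultimately show ?thesis
    using nonneg_diff_nthD[of "D.step 3 m J" "2 * q ^ e * q ^ (m + 4 * (j div 2))" n]
    unfolding two_X_power_mult_nth by simp
qed

lemma M2_step_3:
  assumes "n = 2 * m + 3 + 4 * j" "j \<le> J"
  shows "2 \<le> fps_nth (M2.step 3 m J) n"
proof -
  have red: "M2.reduced 3 = 2 * q ^ 3 + 2 * q ^ 7 + 2 * q ^ 3 * (q ^ 3 * (1 + q ^ 4) * (1 + q ^ 5) + q ^ 5 * (1 + q ^ 4))"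
    unfolding M2.reduced_def atLeastLessThan_2_3 by (simp add: algebra_simps eval_nat_numeral)
  \<comment> \<open>As for the \<open>D\<close>-rank: \<open>2 q^3\<close> and \<open>2 q^7\<close>
    times \<open>q^(2m + 8i)\<close> reach all exponents \<open>2m + 3 + 4j\<close>.\<close>
  define e where "e = (if even j then 3 else 7 :: nat)"
  have "nonneg (M2.step 3 m J - 2 * q ^ e * (q\<^sup>2) ^ (m + 4 * (j div 2)))"
    by (rule M2.step_ge[OF _ _ M2.core_3_ge]) (use assms in \<open>auto simp: red e_def nonneg_intros\<close>)
  moreover have "n = e + 2 * (m + 4 * (j div 2))"
    using assms(1) by (auto simp: e_def elim!: oddE)
  ultimately show ?thesis
    using nonneg_diff_nthD[of "M2.step 3 m J" "2 * q ^ e * q ^ (2 * (m + 4 * (j div 2)))" n]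
    unfolding power_mult[symmetric] two_X_power_mult_nth by simp
qed

section \<open>Monotonicity of the rank counts\<close>

lemma N_bar_mono:
  assumes "Suc n \<noteq> m + 2" "(m, Suc n) \<noteq> (0, 4)"
  shows "N_bar (int m) (int n) \<le> N_bar (int m) (int (Suc n))"
proof (cases "n = 0")
  case True
  have "fps_nth (term_coeff 0 q 1) 1 = 2"
    unfolding D_term_coeff_1 by (simp add: numeral_fps_const)
  moreover define F where "F = 1 + gf D_head D_tail (parts_ge 1)"
  ultimately have "fps_nth (fps_nth (fps_nth F 0) m) 0 \<le>
      (\<Sum>l\<le>1. fps_nth (fps_nth (fps_nth F l) (l + m)) 1)"
    unfolding F_def by (intro D.diagonal_mono_1 functional_eq_D) simp
  then have "int (N_bar (int m) (int 0)) \<le> int (N_bar (int m) (int 1))"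
    unfolding N_bar_eq[OF order_refl] F_def[symmetric] by simp
  then show ?thesis using True by simp
next
  case False
  have "0 \<le> fps_nth (D.step 1 m (Suc n - 1)) (Suc n) \<or>
      (\<exists>k\<in>{2..Suc n}. 0 \<le> fps_nth (D.step 1 m (Suc n - 1)) (Suc n) + fps_nth (D.step k m (Suc n - k)) (Suc n))"
  proof (cases "\<exists>j. Suc n = m + 2 + 2 * j")
    case True
    then obtain j where j: "Suc n = m + 2 + 2 * j" by auto
    have 1: "- 2 \<le> fps_nth (D.step 1 m (Suc n - 1)) (Suc n)"
      using D_step_1[of "Suc n" m "Suc n - 1"] by (auto split: if_splits)
    \<comment> \<open>The deficit at \<open>j = 0\<close> is the excluded case
      \<open>n = m + 2\<close> of the theorem; \<open>j = 1\<close> is covered by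
      \<open>k = 2\<close> and larger \<open>j\<close> by \<open>k = 3\<close>.\<close>
    consider "j = 0" | "j = 1" | "2 \<le> j" by linarith
    then show ?thesis
    proof cases
      case 1
      then show ?thesis using assms(1) j by simp
    next
      case 2
      then have "Suc n = m + 4" "1 \<le> m"
        using j assms(2) by auto
      then have "2 \<le> fps_nth (D.step 2 m (Suc n - 2)) (Suc n)"
        using D_step_2[of m "Suc n - 2"] by metis
      then show ?thesis using 1 False by (intro disjI2 bexI[of _ 2]) auto
    next
      case 3
      then have "2 \<le> fps_nth (D.step 3 m (Suc n - 3)) (Suc n)"
        using j by (intro D_step_3[of _ _ "j - 2"]) auto
      then show ?thesis using 1 3 j by (intro disjI2 bexI[of _ 3]) auto
    qed
  next
    case False
    then show ?thesis
      using D_step_1[of "Suc n" m "Suc n - 1"] by auto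
  qed
  then have "int (N_bar (int m) (int n)) \<le> int (N_bar (int m) (int (Suc n)))"
    using D.diagonal_mono[OF functional_eq_D, of "Suc n" m] False
    unfolding N_bar_eq[OF order_refl] by simp
  then show ?thesis by simp
qed

text \<open>The \<open>k = 3\<close> term compensates every deficit of the \<open>k = 1\<close>
  term, so there are no exceptions.\<close>

lemma N2_bar_mono: "N2_bar (int m) (int n) \<le> N2_bar (int m) (int (Suc n))"
proof (cases "n = 0")
  case True
  have "fps_nth (term_coeff q (q\<^sup>2) 1) 1 = 2"
    unfolding M2_term_coeff_1 by (simp add: numeral_fps_const fps_mult_nth)
  moreover define F where "F = 1 + gf M2_head M2_tail (parts_ge 1)"
  ultimately have "fps_nth (fps_nth (fps_nth F 0) m) 0 \<le>
      (\<Sum>l\<le>1. fps_nth (fps_nth (fps_nth F l) (l + m)) 1)"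
    unfolding F_def by (intro M2.diagonal_mono_1 functional_eq_M2) simp
  then have "int (N2_bar (int m) (int 0)) \<le> int (N2_bar (int m) (int 1))"
    unfolding N2_bar_eq[OF order_refl] F_def[symmetric] by simp
  then show ?thesis using True by simp
next
  case False
  have "0 \<le> fps_nth (M2.step 1 m (Suc n - 1)) (Suc n) \<or>
      (\<exists>k\<in>{2..Suc n}. 0 \<le> fps_nth (M2.step 1 m (Suc n - 1)) (Suc n) + fps_nth (M2.step k m (Suc n - k)) (Suc n))"
  proof (cases "\<exists>j. Suc n = 2 * m + 3 + 4 * j")
    case True
    then obtain j where j: "Suc n = 2 * m + 3 + 4 * j" by auto
    have "- 2 \<le> fps_nth (M2.step 1 m (Suc n - 1)) (Suc n)"
      using M2_step_1[of "Suc n" m "Suc n - 1"] by (auto split: if_splits)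
    moreover have "2 \<le> fps_nth (M2.step 3 m (Suc n - 3)) (Suc n)"
      using j by (intro M2_step_3[of _ _ j]) auto
    moreover have "3 \<in> {2..Suc n}"
      using j by simp
    ultimately show ?thesis by (intro disjI2 bexI[of _ 3]) auto
  next
    case False
    then show ?thesis
      using M2_step_1[of "Suc n" m "Suc n - 1"] by auto
  qed
  then have "int (N2_bar (int m) (int n)) \<le> int (N2_bar (int m) (int (Suc n)))"
    using M2.diagonal_mono[OF functional_eq_M2, of "Suc n" m] False
    unfolding N2_bar_eq[OF order_refl] by simp
  then show ?thesis by simp
qed

theorem theorem1p4:
  shows "(\<forall>m n :: int. m \<ge> 0 \<and> n \<ge> 0 \<and> n \<noteq> m + 2 \<and> (m, n) \<noteq> (0, 4) \<longrightarrow>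
            N_bar m n \<ge> N_bar m (n - 1)) \<and>
         (\<forall>m n :: int. m \<ge> 0 \<and> n \<ge> 0 \<longrightarrow>
            N2_bar m n \<ge> N2_bar m (n - 1))"
proof -
  \<comment> \<open>This settles \<open>n = 0\<close>, where the count at -1 is zero.\<close>
  have empty: "overpartitions_of (- 1) = {}"
    by (auto simp: overpartitions_of_def)
  have 1: "N_bar m (n - 1) \<le> N_bar m n"
    if "m \<ge> 0" "n \<ge> 0" "n \<noteq> m + 2" "(m, n) \<noteq> (0, 4)" for m n :: int
  proof (cases "n = 0")
    case True
    then show ?thesis by (simp add: N_bar_def empty)
  next
    case False
    obtain m' where m': "m = int m'"
      using \<open>m \<ge> 0\<close> nonneg_int_cases by blast
    obtain n' where n': "n = int (Suc n')"
      using False \<open>n \<ge> 0\<close> by (metis nonneg_int_cases not0_implies_Suc of_nat_0)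
    show ?thesis
      using N_bar_mono[of n' m'] that m' n' by auto
  qed
  have 2: "N2_bar m (n - 1) \<le> N2_bar m n" if "m \<ge> 0" "n \<ge> 0" for m n :: int
  proof (cases "n = 0")
    case True
    then show ?thesis by (simp add: N2_bar_def empty)
  next
    case False
    obtain m' where m': "m = int m'"
      using \<open>m \<ge> 0\<close> nonneg_int_cases by blast
    obtain n' where n': "n = int (Suc n')"
      using False \<open>n \<ge> 0\<close> by (metis nonneg_int_cases not0_implies_Suc of_nat_0)
    show ?thesis
      using N2_bar_mono[of m' n'] that m' n' by auto
  qed
  show ?thesis
    using 1 2 by blast
qed

end
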